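(* Let $\Omega\subset\mathbb{R}^3$ be a bounded domain with $C^1$ convex boundary $\partial\Omega$. Consider the stationary radiative transfer equation with constant absorption coefficient $$n\cdot\nabla_x I_\nu(x,n)=B_\nu(T(x))-I_\nu(x,n),\qquad x\in\Omega,\ n\in\mathbb{S}^2,\ \nu>0,$$ coupled with the conservation law $$\nabla_x\cdot\mathcal{F}(x)=0 \ \text{ in }\Omega,\qquad \mathcal{F}(x)=\int_0^\infty d\nu\int_{\mathbb{S}^2} n\,I_\nu(x,n)\,dn,$$ and the incoming boundary condition $$I_\nu(x,n)=g_\nu(n)\ge 0\quad\text{for }x\in\partial\Omega,\ n\in\mathbb{S}^2,\ n\cdot n_x<0,\qquad \int_{\mathbb{S}^2}\int_0^\infty g_\nu(n)\,d\nu\,dn<+\infty .$$ Then this system admits a unique positive solution of the local temperature distribution $T=T(x)\in L^4(\Omega)$.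
   Context: $B_\nu(T)=\frac{2h\nu^3}{c^2}\frac{1}{e^{h\nu/(kT)}-1}$ is the Planck (black-body) emission, with $h,c,k>0$ physical constants. $I_\nu(x,n)$ is the intensity of radiation of frequency $\nu$ at $x$ in direction $n$; $n_x$ is the outward unit normal at $x\in\partial\Omega$. The boundary profile $g_\nu(n)$ depends only on $\nu$ and $n$. For $(x,n)\in\Omega\times\mathbb{S}^2$, let $y(x,n)\in\partial\Omega$ be the point where the backward ray from $x$ in direction $-n$ meets $\partial\Omega$ and $s(x,n)=|x-y(x,n)|$. Given $T$, the intensity is obtained by integrating the transport equation along rays: $$I_\nu(x,n)=g_\nu(n)e^{-s(x,n)}+\int_0^{s(x,n)}e^{-(s(x,n)-\xi)}B_\nu(T(y(x,n)+\xi n))\,d\xi .$$ $T$ is a solution if the flux $\mathcal{F}$ of this $I_\nu$ is divergence-free in $\Omega$ (in the sense of distributions).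
   Formalization: For zero incoming radiation (g = 0 almost everywhere) the only solution is T = 0, so "positive" is read as T ≥ 0 almost everywhere, with T > 0 almost everywhere whenever the incoming radiation has nonzero total energy; uniqueness is among nonnegative L^4 solutions. *)

theory Defs
  imports "HOL-Analysis.Analysis"
begin

text \<open>
  Elements of \<open>L\<^sup>4(\<Omega>)\<close> are represented by Borel functions, with equality almost everywhere.
  Values outside \<open>\<Omega>\<close> are irrelevant.
\<close>

definition in_L4 :: "(real^3) set \<Rightarrow> (real^3 \<Rightarrow> real) \<Rightarrow> bool" where
  "in_L4 \<Omega> T \<longleftrightarrow>
     set_borel_measurable borel \<Omega> T \<and> set_integrable lborel \<Omega> (\<lambda>x. \<bar>T x\<bar> ^ 4)"

text \<open>
  Locally, up to a rotation, \<open>\<Omega>\<close> is the region strictly above the graph of a \<open>C\<^sup>1\<close> function.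
  Here \<open>e\<close> is the upward direction, and only the restriction of \<open>\<gamma>\<close> to the plane through 0
  orthogonal to \<open>e\<close> enters; a \<open>C\<^sup>1\<close> function on that plane extends to all of space by making it
  constant along \<open>e\<close>.
\<close>

definition C1_boundary :: "(real^3) set \<Rightarrow> bool" where
  "C1_boundary \<Omega> \<longleftrightarrow>
     (\<forall>p\<in>frontier \<Omega>. \<exists>r>0. \<exists>e \<gamma> D. norm e = 1 \<and>
        (\<forall>z. GDERIV \<gamma> z :> D z) \<and> continuous_on UNIV D \<and>
        \<Omega> \<inter> ball p r = {x \<in> ball p r. \<gamma> (x - (x \<bullet> e) *\<^sub>R e) < x \<bullet> e})"

text \<open>
  Surface measure on the unit sphere: the measure of \<open>A\<close> is three times the volume of the cone
  \<open>{r n | 0 < r < 1, n \<in> A}\<close>; the factor 3 is the dimension, i.e. it cancels the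
  \<open>\<integral>\<^sub>0\<^sup>1 r\<^sup>2 dr = 1/3\<close> of polar coordinates.
\<close>

definition sphere_measure :: "(real^3) measure" where
  "sphere_measure =
     distr (scale_measure 3 (restrict_space lborel (ball 0 1 - {0})))
           (restrict_space borel (sphere 0 1)) sgn"

text \<open>
  For \<open>T = 0\<close> division by zero makes this 0, which is the limit as \<open>T\<close> tends to 0 from the right.
\<close>

definition planck :: "real \<Rightarrow> real \<Rightarrow> real \<Rightarrow> real \<Rightarrow> real \<Rightarrow> real" where
  "planck h c k \<nu> T = 2 * h * \<nu> ^ 3 / c\<^sup>2 * (1 / (exp (h * \<nu> / (k * T)) - 1))"

definition entry_point :: "(real^3) set \<Rightarrow> real^3 \<Rightarrow> real^3 \<Rightarrow> real^3" where
  "entry_point \<Omega> x n = (THE y. y \<in> frontier \<Omega> \<and> (\<exists>t>0. y = x - t *\<^sub>R n))"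

definition entry_dist :: "(real^3) set \<Rightarrow> real^3 \<Rightarrow> real^3 \<Rightarrow> real" where
  "entry_dist \<Omega> x n = norm (x - entry_point \<Omega> x n)"

text \<open>
  The solution, by integration along rays, of the transport equation
  \<open>n \<cdot> \<nabla>I = B\<^sub>\<nu>(T) - I\<close> with value \<open>g \<nu> n\<close> at the point where the ray enters \<open>\<Omega>\<close>.
\<close>

definition intensity ::
  "real \<Rightarrow> real \<Rightarrow> real \<Rightarrow> (real^3) set \<Rightarrow> (real \<Rightarrow> real^3 \<Rightarrow> real) \<Rightarrow> (real^3 \<Rightarrow> real) \<Rightarrow>
     real \<Rightarrow> real^3 \<Rightarrow> real^3 \<Rightarrow> real" where
  "intensity h c k \<Omega> g T \<nu> x n =
     (let y = entry_point \<Omega> x n; s = entry_dist \<Omega> x n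
      in g \<nu> n * exp (- s) +
         (LINT \<xi>:{0<..<s}|lborel. exp (- (s - \<xi>)) * planck h c k \<nu> (T (y + \<xi> *\<^sub>R n))))"

definition flux ::
  "real \<Rightarrow> real \<Rightarrow> real \<Rightarrow> (real^3) set \<Rightarrow> (real \<Rightarrow> real^3 \<Rightarrow> real) \<Rightarrow> (real^3 \<Rightarrow> real) \<Rightarrow>
     real^3 \<Rightarrow> real^3" where
  "flux h c k \<Omega> g T x =
     (LINT \<nu>:{0<..}|lborel. (LINT n|sphere_measure. intensity h c k \<Omega> g T \<nu> x n *\<^sub>R n))"

primrec Ck :: "nat \<Rightarrow> (real^3 \<Rightarrow> real) \<Rightarrow> bool" where
  "Ck 0 f \<longleftrightarrow> continuous_on UNIV f"
| "Ck (Suc m) f \<longleftrightarrow>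
     (\<forall>x. f differentiable (at x)) \<and> (\<forall>v. Ck m (\<lambda>x. frechet_derivative f (at x) v))"

definition test_function :: "(real^3) set \<Rightarrow> (real^3 \<Rightarrow> real) \<Rightarrow> bool" where
  "test_function \<Omega> \<phi> \<longleftrightarrow>
     (\<forall>m. Ck m \<phi>) \<and> compact (closure {x. \<phi> x \<noteq> 0}) \<and> closure {x. \<phi> x \<noteq> 0} \<subseteq> \<Omega>"

text \<open>
  The integrand below is \<open>F \<cdot> \<nabla>\<phi>\<close>. Local integrability, required for \<open>F\<close> to define a
  distribution, also prevents the integral from being 0 merely for want of integrability.
\<close>

definition divergence_free_on :: "(real^3) set \<Rightarrow> (real^3 \<Rightarrow> real^3) \<Rightarrow> bool" where
  "divergence_free_on \<Omega> F \<longleftrightarrow>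
     (\<forall>K. compact K \<and> K \<subseteq> \<Omega> \<longrightarrow> set_integrable lborel K F) \<and>
     (\<forall>\<phi>. test_function \<Omega> \<phi> \<longrightarrow>
        (LINT x:\<Omega>|lborel. frechet_derivative \<phi> (at x) (F x)) = 0)"

text \<open>
  For \<open>g = 0\<close> the solution is \<open>T = 0\<close>, so the class of admissible temperatures has to be that of
  nonnegative functions.
\<close>

definition temperature_solution ::
  "real \<Rightarrow> real \<Rightarrow> real \<Rightarrow> (real^3) set \<Rightarrow> (real \<Rightarrow> real^3 \<Rightarrow> real) \<Rightarrow> (real^3 \<Rightarrow> real) \<Rightarrow> bool" where
  "temperature_solution h c k \<Omega> g T \<longleftrightarrow>
     in_L4 \<Omega> T \<and> (AE x in lborel. x \<in> \<Omega> \<longrightarrow> 0 \<le> T x) \<and>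
     divergence_free_on \<Omega> (flux h c k \<Omega> g T)"

definition boundary_energy :: "(real \<Rightarrow> real^3 \<Rightarrow> real) \<Rightarrow> ennreal" where
  "boundary_energy g =
     (\<integral>\<^sup>+ n. (\<integral>\<^sup>+ \<nu>\<in>{0<..}. ennreal (g \<nu> n) \<partial>lborel) \<partial>sphere_measure)"

end

theory Submission
  imports
    Defs
    "HOL-Computational_Algebra.Polynomial"
    "HOL-Probability.Distributions"
begin

text \<open>
  Integrated over all frequencies, the Planck emission is \<open>u = \<sigma> T\<^sup>4\<close>, so that the problem becomes linear
  in \<open>u\<close>. Put \<open>G n = \<integral> g \<nu> n d\<nu>\<close>. The frequency-integrated intensity is
  \<open>J(x, n) = G n exp(-s(x, n)) + \<integral>\<^sub>0\<^sup>s exp(-t) u(x - t n) dt\<close> and solves \<open>n \<cdot> \<nabla>J = u - J\<close>. Hence the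
  divergence of its flux is \<open>m u - \<integral> J dn\<close>, where \<open>m\<close> is the area of the sphere, and the flux is
  divergence-free exactly if \<open>m u = \<integral> J dn\<close>: at almost every point, emission balances absorption
  (\<open>total_flux_divergence_free_iff\<close>).

  This balance is an affine fixed point equation in \<open>L\<^sup>1(\<Omega>)\<close>. Its linear part sends \<open>u\<close> to the mean over
  directions of \<open>\<integral> exp(-t) u(x - t n) dt\<close> and is a contraction: it moves each photon by an exponentially
  distributed distance, and a photon that has moved further than the diameter of \<open>\<Omega>\<close> has escaped
  (\<open>scattering_contraction\<close>). The Neumann series of the incoming radiation therefore converges to a
  nonnegative solution, which is positive as soon as some radiation comes in, and integrable solutions
  are unique. Finally \<open>T = (u / \<sigma>)\<^sup>1\<^sup>/\<^sup>4\<close>, and the \<open>L\<^sup>1\<close> bound on \<open>u\<close> is the \<open>L\<^sup>4\<close> bound on \<open>T\<close>.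

  Two devices keep the analysis elementary. Extending \<open>u\<close> by zero turns the integral along the ray into
  the expectation \<open>ray_avg\<close> of \<open>u(x - t n)\<close> for an exponential path length \<open>t\<close>. The factor
  \<open>exp(-s(x, n))\<close> is then one minus the same expectation of the indicator of \<open>\<Omega>\<close>, so that boundary and
  interior terms obey the same identities. The divergence is computed weakly: the adjoint of averaging
  along \<open>n\<close> is averaging along \<open>-n\<close>, and on a single ray the claim is an integration by parts
  (\<open>transport_weak_form\<close>). To return from test functions to points one needs enough of them; products of
  rescaled copies of \<open>exp(-1/t)\<close> approximate indicators of boxes.

  The intensity of a given frequency may fail to be integrable along exceptional rays, and a temperature
  is nonnegative only almost everywhere. Both defects are harmless because, for almost every point, almost
  every ray through it meets a given null set in a null set (\<open>AE_along_rays\<close>), and a given integrable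
  function is integrable along almost every ray through it (\<open>AE_integrable_along_rays\<close>).
\<close>

section \<open>Test functions separate integrable functions\<close>

text \<open>
  The polynomial factor makes the family closed under differentiation, so that smoothness of
  \<open>exp(-1/t)\<close> at 0 follows from one derivative computation instead of an induction on the order.
\<close>

definition flat_exp :: "real poly \<Rightarrow> real \<Rightarrow> real" where
  "flat_exp p t = (if t \<le> 0 then 0 else poly p (1 / t) * exp (- (1 / t)))"

lemma poly_times_exp_tendsto_0:
  fixes p :: "real poly"
  shows "((\<lambda>s. poly p s * exp (- s)) \<longlongrightarrow> 0) at_top"
proof -
  have "((\<lambda>s. \<Sum>i\<le>degree p. coeff p i * (s ^ i / exp s)) \<longlongrightarrow> (\<Sum>i\<le>degree p. coeff p i * 0)) at_top"
    by (intro tendsto_sum tendsto_mult tendsto_const tendsto_power_div_exp_0)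
  then show ?thesis
    by (simp add: poly_altdef sum_divide_distrib exp_minus divide_inverse sum_distrib_right mult.assoc)
qed

lemma flat_tendsto_0: "(flat_exp p \<longlongrightarrow> 0) (at 0)"
proof -
  have "((\<lambda>t. poly p (inverse t) * exp (- inverse t)) \<longlongrightarrow> 0) (at_right 0)"
    by (rule filterlim_compose[OF poly_times_exp_tendsto_0 filterlim_inverse_at_top_right])
  then have r: "(flat_exp p \<longlongrightarrow> 0) (at_right 0)"
    by (rule Lim_transform_eventually)
       (auto simp: eventually_at_filter flat_exp_def inverse_eq_divide)
  have "(flat_exp p \<longlongrightarrow> 0) (at_left 0)"
    by (rule Lim_transform_eventually[OF tendsto_const])
       (auto simp: eventually_at_filter flat_exp_def)
  with r show ?thesis by (simp add: filterlim_at_split)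
qed

text \<open>
  With \<open>s = 1/t\<close>, the derivative of \<open>p(s) exp(-s)\<close> in \<open>t\<close> is \<open>s\<^sup>2 (p(s) - p'(s)) exp(-s)\<close>. At 0 the difference
  quotient of the function for \<open>p\<close> is the function for \<open>s p(s)\<close>, which tends to 0.
\<close>

lemma has_field_derivative_flat:
  "(flat_exp p has_field_derivative flat_exp ([:0, 0, 1:] * (p - pderiv p)) t) (at t)"
proof -
  consider "t < 0" | "t = 0" | "t > 0" by linarith
  then show ?thesis
  proof cases
    case 1
    have "((\<lambda>_. 0) has_field_derivative 0) (at t)" by simp
    then have "(flat_exp p has_field_derivative 0) (at t)"
      by (rule has_field_derivative_transform_within_open[where S = "{..<0}"])
         (use 1 in \<open>auto simp: flat_exp_def\<close>)
    then show ?thesis using 1 by (simp add: flat_exp_def)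
  next
    case 2
    have "((\<lambda>h. (flat_exp p (0 + h) - flat_exp p 0) / h) \<longlongrightarrow> 0) (at 0)"
      by (rule Lim_transform_eventually[OF flat_tendsto_0[of "pCons 0 p"]])
         (auto simp: flat_exp_def eventually_at_filter)
    then show ?thesis using 2 by (simp add: DERIV_def flat_exp_def)
  next
    case 3
    have "((\<lambda>t. poly p (1 / t) * exp (- (1 / t))) has_field_derivative
            flat_exp ([:0, 0, 1:] * (p - pderiv p)) t) (at t)"
      using 3 by (auto intro!: derivative_eq_intros poly_DERIV[THEN DERIV_chain2]
          simp: flat_exp_def field_simps power2_eq_square)
    then show ?thesis
      by (rule has_field_derivative_transform_within_open[where S = "{0<..}"])
         (use 3 in \<open>auto simp: flat_exp_def\<close>)
  qed
qed

text \<open>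
  The smallest class containing the building blocks of the bumps and closed under sums and products.
  Each directional derivative stays in the class, which gives all iterated derivatives at once.
\<close>

inductive flat_algebra :: "(real^3 \<Rightarrow> real) \<Rightarrow> bool" where
  ridge: "flat_algebra (\<lambda>x. flat_exp p (x \<bullet> v + \<beta>))"
| const: "flat_algebra (\<lambda>x. a)"
| add: "flat_algebra f \<Longrightarrow> flat_algebra f' \<Longrightarrow> flat_algebra (\<lambda>x. f x + f' x)"
| mult: "flat_algebra f \<Longrightarrow> flat_algebra f' \<Longrightarrow> flat_algebra (\<lambda>x. f x * f' x)"

lemma flat_algebra_closed_under_derivative:
  "flat_algebra f \<Longrightarrow>
    \<exists>D. (\<forall>x. (f has_derivative D x) (at x)) \<and> (\<forall>v. flat_algebra (\<lambda>x. D x v))"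
proof (induction rule: flat_algebra.induct)
  case (ridge p v \<beta>)
  let ?q = "[:0, 0, 1:] * (p - pderiv p)"
  have "((\<lambda>x. flat_exp p (x \<bullet> v + \<beta>)) has_derivative (\<lambda>w. (w \<bullet> v) * flat_exp ?q (x \<bullet> v + \<beta>))) (at x)" for x
    by (rule has_derivative_eq_rhs[OF has_derivative_compose[OF _
          has_field_derivative_flat[unfolded has_field_derivative_def]]])
       (auto intro!: derivative_eq_intros)
  then show ?case
    by (intro exI[of _ "\<lambda>x w. (w \<bullet> v) * flat_exp ?q (x \<bullet> v + \<beta>)"])
       (auto intro!: flat_algebra.intros)
next
  case (const a)
  show ?case by (intro exI[of _ "\<lambda>_ _. 0"]) (auto intro: flat_algebra.intros)
next
  case (add f f')
  then obtain D D' where "\<And>x. (f has_derivative D x) (at x)" "\<And>x. (f' has_derivative D' x) (at x)"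
    "\<And>v. flat_algebra (\<lambda>x. D x v)" "\<And>v. flat_algebra (\<lambda>x. D' x v)" by blast
  then show ?case
    by (intro exI[of _ "\<lambda>x v. D x v + D' x v"]) (auto intro: flat_algebra.intros has_derivative_add)
next
  case (mult f f')
  then obtain D D' where "\<And>x. (f has_derivative D x) (at x)" "\<And>x. (f' has_derivative D' x) (at x)"
    "\<And>v. flat_algebra (\<lambda>x. D x v)" "\<And>v. flat_algebra (\<lambda>x. D' x v)" by blast
  with mult.hyps show ?case
    by (intro exI[of _ "\<lambda>x v. f x * D' x v + D x v * f' x"])
       (auto intro!: flat_algebra.intros has_derivative_mult)
qed

lemma flat_algebra_imp_Ck: "flat_algebra f \<Longrightarrow> Ck m f"
proof (induction m arbitrary: f)
  case 0
  obtain D where "\<And>x. (f has_derivative D x) (at x)"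
    using flat_algebra_closed_under_derivative[OF 0] by blast
  then show ?case
    by (auto intro!: continuous_at_imp_continuous_on has_derivative_continuous)
next
  case (Suc m)
  obtain D where D: "\<And>x. (f has_derivative D x) (at x)" and A: "\<And>v. flat_algebra (\<lambda>x. D x v)"
    using flat_algebra_closed_under_derivative[OF Suc.prems] by blast
  have "frechet_derivative f (at x) = D x" for x
    using D by (metis frechet_derivative_at)
  with Suc.IH[OF A] D show ?case by (auto simp: differentiable_def)
qed

lemma flat_algebra_prod:
  "finite I \<Longrightarrow> (\<And>i. i \<in> I \<Longrightarrow> flat_algebra (f i)) \<Longrightarrow> flat_algebra (\<lambda>x. \<Prod>i\<in>I. f i x)"
  by (induction I rule: finite_induct) (auto intro: flat_algebra.intros)

text \<open>
  Scaling the argument by \<open>Suc j\<close> amounts to taking the \<open>Suc j\<close>-th root of the factors \<open>exp(-1/t)\<close>, so that the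
  bumps tend to the indicator of the open box while their support stays fixed.
\<close>

definition box_bump :: "real^3 \<Rightarrow> real^3 \<Rightarrow> nat \<Rightarrow> real^3 \<Rightarrow> real" where
  "box_bump a b j x =
     (\<Prod>i\<in>Basis. flat_exp 1 (real (Suc j) * (x \<bullet> i - a \<bullet> i)) * flat_exp 1 (real (Suc j) * (b \<bullet> i - x \<bullet> i)))"

lemma flat_algebra_box_bump: "flat_algebra (box_bump a b j)"
proof -
  have "flat_algebra (\<lambda>x. flat_exp 1 (x \<bullet> (real (Suc j) *\<^sub>R i) + - (real (Suc j) * (a \<bullet> i))) *
          flat_exp 1 (x \<bullet> (- (real (Suc j) *\<^sub>R i)) + real (Suc j) * (b \<bullet> i)))" for i
    by (intro flat_algebra.intros)
  then have "flat_algebra (\<lambda>x. flat_exp 1 (real (Suc j) * (x \<bullet> i - a \<bullet> i)) * flat_exp 1 (real (Suc j) * (b \<bullet> i - x \<bullet> i)))" for i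
    by (simp add: right_diff_distrib)
  then have "flat_algebra (\<lambda>x. \<Prod>i\<in>Basis. flat_exp 1 (real (Suc j) * (x \<bullet> i - a \<bullet> i)) * flat_exp 1 (real (Suc j) * (b \<bullet> i - x \<bullet> i)))"
    by (intro flat_algebra_prod) auto
  then show ?thesis by (simp add: box_bump_def[abs_def])
qed

lemma flat_1_bounds: "0 \<le> flat_exp 1 t" "flat_exp 1 t \<le> 1"
  by (auto simp: flat_exp_def)

lemma box_bump_bounds: "0 \<le> box_bump a b j x" "box_bump a b j x \<le> 1"
  unfolding box_bump_def
  by (auto intro!: prod_nonneg prod_le_1 mult_le_one simp: flat_1_bounds)

lemma box_bump_outside: "x \<notin> box a b \<Longrightarrow> box_bump a b j x = 0"
proof -
  assume "x \<notin> box a b"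
  then obtain i where i: "i \<in> Basis" "x \<bullet> i \<le> a \<bullet> i \<or> b \<bullet> i \<le> x \<bullet> i"
    by (auto simp: mem_box not_less)
  then have "real (Suc j) * (x \<bullet> i - a \<bullet> i) \<le> 0 \<or> real (Suc j) * (b \<bullet> i - x \<bullet> i) \<le> 0"
    by (simp only: mult_le_0_iff) auto
  then have "flat_exp 1 (real (Suc j) * (x \<bullet> i - a \<bullet> i)) * flat_exp 1 (real (Suc j) * (b \<bullet> i - x \<bullet> i)) = 0"
    unfolding flat_exp_def by auto
  with i(1) show ?thesis
    unfolding box_bump_def by (intro prod_zero) auto
qed

lemma flat_1_scaled_tendsto: "t > 0 \<Longrightarrow> (\<lambda>j. flat_exp 1 (real (Suc j) * t)) \<longlonglongrightarrow> 1"
proof -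
  assume t: "t > 0"
  have "(\<lambda>j. exp (- (inverse (real (Suc j)) * (1 / t)))) \<longlonglongrightarrow> exp (- (0 * (1 / t)))"
    by (intro tendsto_intros LIMSEQ_inverse_real_of_nat)
  moreover have "flat_exp 1 (real (Suc j) * t) = exp (- (inverse (real (Suc j)) * (1 / t)))" for j
  proof -
    have "0 < real (Suc j) * t" using t by (intro mult_pos_pos) auto
    then show ?thesis by (simp add: flat_exp_def divide_inverse)
  qed
  ultimately show ?thesis by simp
qed

lemma box_bump_tendsto: "(\<lambda>j. box_bump a b j x) \<longlonglongrightarrow> indicat_real (box a b) x"
proof (cases "x \<in> box a b")
  case True
  have "(\<lambda>j. box_bump a b j x) \<longlonglongrightarrow> (\<Prod>i\<in>(Basis :: (real^3) set). 1 * 1)"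
    unfolding box_bump_def
    by (intro tendsto_prod tendsto_mult flat_1_scaled_tendsto) (use True in \<open>auto simp: mem_box\<close>)
  with True show ?thesis by simp
qed (simp add: box_bump_outside)

lemma test_function_box_bump:
  assumes "cbox a b \<subseteq> \<Omega>"
  shows "test_function \<Omega> (box_bump a b j)"
proof -
  have "closure {x. box_bump a b j x \<noteq> 0} \<subseteq> cbox a b"
    by (rule closure_minimal) (use box_bump_outside box_subset_cbox in blast)+
  with assms show ?thesis
    unfolding test_function_def
    by (auto intro: flat_algebra_imp_Ck flat_algebra_box_bump
        bounded_subset[OF bounded_cbox] simp: compact_eq_bounded_closed)
qed

lemma box_Int_is_box:
  fixes a b c d :: "'a::euclidean_space"
  shows "\<exists>a' b'. box a b \<inter> box c d = box a' b'"
  by (intro exI) (rule box_Int_box)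

text \<open>
  The sets over which \<open>f\<close> integrates to zero form a Dynkin system, and boxes are an intersection-stable
  generator of the Borel sets. That the whole space belongs to the system follows by exhausting it with
  boxes.
\<close>

lemma AE_zero_if_box_integrals_zero:
  fixes f :: "'a::euclidean_space \<Rightarrow> real"
  assumes f: "integrable lborel f"
    and boxes: "\<And>a b. (LINT x:box a b|lborel. f x) = 0"
  shows "AE x in lborel. f x = 0"
proof (rule sigma_finite_measure.density_zero[OF sigma_finite_lborel f])
  \<comment> \<open>Complements in the Dynkin system need the integral over the whole space.\<close>
  have UN: "(\<Union>n. box (- (real n *\<^sub>R One)) (real n *\<^sub>R One)) = (UNIV :: 'a set)"
    by (rule UN_box_eq_UNIV)
  have int: "set_integrable lborel A f" if "A \<in> sets borel" for A
    using integrable_mult_indicator[OF _ f, of A] that by (simp add: set_integrable_def)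
  have all: "(LINT x|lborel. f x) = 0"
  proof (rule LIMSEQ_unique)
    let ?B = "\<lambda>n. box (- (real n *\<^sub>R One)) (real n *\<^sub>R One) :: 'a set"
    have "(\<lambda>n. LINT x|lborel. indicator (?B n) x *\<^sub>R f x) \<longlonglongrightarrow> (LINT x|lborel. f x)"
    proof (rule integral_dominated_convergence[where w = "\<lambda>x. norm (f x)"])
      show "AE x in lborel. (\<lambda>n. indicator (?B n) x *\<^sub>R f x) \<longlonglongrightarrow> f x"
      proof (rule AE_I2)
        fix x :: 'a
        obtain n where n: "x \<in> ?B n" using UN by blast
        have "?B n \<subseteq> ?B m" if "n \<le> m" for m
          using that by (auto simp: mem_box) (smt (verit) of_nat_le_iff)+
        with n have "\<forall>m\<ge>n. indicator (?B m) x *\<^sub>R f x = f x"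
          by (auto simp: indicator_def)
        then show "(\<lambda>n. indicator (?B n) x *\<^sub>R f x) \<longlonglongrightarrow> f x"
          by (intro tendsto_eventually) (auto simp: eventually_sequentially)
      qed
    qed (use f in \<open>auto simp: indicator_def\<close>)
    then show "(\<lambda>n. 0::real) \<longlonglongrightarrow> (LINT x|lborel. f x)"
      using boxes by (simp add: set_lebesgue_integral_def)
  qed simp
  fix A :: "'a set" assume "A \<in> sets lborel"
  then have A: "A \<in> sigma_sets UNIV (range (\<lambda>(a, b). box a b))"
    by (simp add: borel_eq_box)
  have Int: "Int_stable (range (\<lambda>(a, b). box a b :: 'a set))"
    by (auto simp: Int_stable_def box_Int_box)
  have sig: "sigma_sets UNIV (range (\<lambda>(a, b). box a b :: 'a set)) = sets borel"
    by (simp add: borel_eq_box)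
  have sub: "range (\<lambda>(a, b). box a b :: 'a set) \<subseteq> Pow UNIV"
    by simp
  from Int sub A show "(LINT x:A|lborel. f x) = 0"
  proof (induction rule: sigma_sets_induct_disjoint)
    case (compl A)
    then have A: "A \<in> sets borel" using sig by simp
    have "(LINT x:UNIV - A|lborel. f x) = (LINT x|lborel. f x - indicator A x *\<^sub>R f x)"
      unfolding set_lebesgue_integral_def
      by (intro Bochner_Integration.integral_cong) (auto simp: indicator_def)
    also have "\<dots> = 0"
      using int[OF A] f compl all
      by (subst Bochner_Integration.integral_diff) (auto simp: set_lebesgue_integral_def set_integrable_def)
    finally show ?case .
  next
    case (union A)
    then have A: "A i \<in> sets borel" for i using sig by auto
    have "(LINT x:(\<Union>i. A i)|lborel. f x) = (\<Sum>i. (LINT x:A i|lborel. f x))"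
    proof (rule lebesgue_integral_countable_add)
      show "A i \<inter> A j = {}" if "i \<noteq> j" for i j
        using union(1) that by (auto simp: disjoint_family_on_def)
      show "set_integrable lborel (\<Union>i. A i) f"
        by (rule int) (use A in auto)
    qed (use A in auto)
    then show ?case using union by simp
  qed (use boxes in \<open>auto simp: set_lebesgue_integral_def\<close>)
qed

text \<open>
  The fundamental lemma of the calculus of variations. Letting bumps tend to indicators shows that the
  integral of \<open>f\<close> over each box in \<open>\<Omega>\<close> vanishes, and countably many such boxes cover \<open>\<Omega>\<close>.
\<close>

lemma AE_zero_if_orthogonal_to_test_functions:
  assumes \<Omega>: "open \<Omega>" and f: "integrable lborel f"
    and orth: "\<And>\<phi>. test_function \<Omega> \<phi> \<Longrightarrow> (LINT x|lborel. \<phi> x * f x) = 0"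
  shows "AE x in lborel. x \<in> \<Omega> \<longrightarrow> f x = 0"
proof -
  have inner: "(LINT x:box a b|lborel. f x) = 0" if "cbox a b \<subseteq> \<Omega>" for a b
  proof -
    have [measurable]: "box_bump a b j \<in> borel_measurable borel" for j
      using flat_algebra_imp_Ck[OF flat_algebra_box_bump, of 0 a b j]
      by (simp add: borel_measurable_continuous_onI)
    have "(\<lambda>j. LINT x|lborel. box_bump a b j x * f x) \<longlonglongrightarrow> (LINT x|lborel. indicat_real (box a b) x * f x)"
    proof (rule integral_dominated_convergence[where w = "\<lambda>x. norm (f x)"])
      show "AE x in lborel. (\<lambda>j. box_bump a b j x * f x) \<longlonglongrightarrow> indicat_real (box a b) x * f x"
        by (intro AE_I2 tendsto_intros box_bump_tendsto)
      show "AE x in lborel. norm (box_bump a b j x * f x) \<le> norm (f x)" for j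
        using box_bump_bounds[of a b j] by (auto simp: abs_mult intro!: mult_left_le_one_le)
    qed (use f in \<open>auto\<close>)
    moreover have "(LINT x|lborel. box_bump a b j x * f x) = 0" for j
      by (rule orth[OF test_function_box_bump[OF that]])
    ultimately show ?thesis
      by (simp add: set_lebesgue_integral_def LIMSEQ_unique[OF _ tendsto_const])
  qed
  obtain \<D> where D: "countable \<D>" "\<D> \<subseteq> Pow \<Omega>"
      "\<And>X. X \<in> \<D> \<Longrightarrow> \<exists>a b. X = cbox a b" "\<Union>\<D> = \<Omega>"
    by (rule open_countable_Union_open_cbox[OF \<Omega>]) blast
  have "AE x in lborel. \<forall>X\<in>\<D>. x \<in> X \<longrightarrow> f x = 0"
  proof (subst AE_ball_countable[OF D(1)], intro ballI)
    fix X assume "X \<in> \<D>"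
    then obtain a b where X: "X = cbox a b" and ab: "cbox a b \<subseteq> \<Omega>" using D(2,3) by blast
    have "AE x in lborel. indicat_real (box a b) x * f x = 0"
    proof (rule AE_zero_if_box_integrals_zero)
      show "integrable lborel (\<lambda>x. indicat_real (box a b) x * f x)"
        using integrable_mult_indicator[OF _ f, of "box a b"] by simp
      fix c d
      obtain a' b' where I: "box c d \<inter> box a b = box a' b'"
        using box_Int_is_box by metis
      moreover have "cbox a' b' \<subseteq> \<Omega> \<or> box a' b' = {}"
      proof (cases "box a' b' = {}")
        case False
        have "closure (box a' b') \<subseteq> cbox a b"
          using I box_subset_cbox[of a b] by (intro closure_minimal) auto
        with False ab show ?thesis by simp
      qed simp
      ultimately have "(LINT x:box c d \<inter> box a b|lborel. f x) = 0"
        using inner[of a' b'] by (auto simp: set_lebesgue_integral_def)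
      then show "(LINT x:box c d|lborel. indicat_real (box a b) x * f x) = 0"
        by (simp add: set_lebesgue_integral_def indicator_inter_arith mult.assoc)
    qed
    \<comment> \<open>The cover consists of closed boxes, the integrals concern open ones; the faces are null sets.\<close>
    moreover have "AE x in lborel. x \<notin> cbox a b - box a b"
      using negligible_frontier_interval[of a b]
      by (intro AE_not_in) (simp add: negligible_iff_null_sets null_sets_completion_iff)
    ultimately show "AE x in lborel. x \<in> X \<longrightarrow> f x = 0"
      by eventually_elim (auto simp: indicator_def X)
  qed
  then show ?thesis
    by eventually_elim (use D(4) in auto)
qed

section \<open>Averages along a ray\<close>

text \<open>
  The weight \<open>exp(-t)\<close> is the law of the distance that a photon travels before it is absorbed. Working with
  this probability measure replaces truncated weighted integrals over rays by expectations.
\<close>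

definition path_length_law :: "real measure" where
  "path_length_law = density lborel (exponential_density 1)"

interpretation path_length: prob_space path_length_law
  unfolding path_length_law_def by (rule prob_space_exponential_density) simp

lemma sets_path_length_law [measurable_cong, simp]: "sets path_length_law = sets borel"
  by (simp add: path_length_law_def)

lemma space_path_length_law [simp]: "space path_length_law = UNIV"
  by (simp add: path_length_law_def)

interpretation lborel_path: pair_sigma_finite "lborel :: 'a::euclidean_space measure" path_length_law ..

lemma AE_path_length_pos: "AE t in path_length_law. 0 < t"
proof -
  have "AE t in lborel. 0 < ennreal (exponential_density 1 t) \<longrightarrow> 0 < t"
    using AE_lborel_singleton[of "0::real"]
    by eventually_elim (auto simp: exponential_density_def not_less)
  then show ?thesis
    unfolding path_length_law_def by (subst AE_density) auto
qed

lemma integral_path_length_law: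
  fixes f :: "real \<Rightarrow> real"
  assumes [measurable]: "f \<in> borel_measurable borel"
  shows "(LINT t|path_length_law. f t) = (LINT t:{0<..}|lborel. exp (- t) * f t)"
proof -
  have "(LINT t|path_length_law. f t) = (LINT t|lborel. exponential_density 1 t * f t)"
    unfolding path_length_law_def
    by (subst integral_density) (auto simp: exponential_density_def)
  also have "\<dots> = (LINT t:{0<..}|lborel. exp (- t) * f t)"
    unfolding set_lebesgue_integral_def
  proof (rule integral_cong_AE)
    show "AE t in lborel. exponential_density 1 t * f t = indicat_real {0<..} t *\<^sub>R (exp (- t) * f t)"
      using AE_lborel_singleton[of "0::real"]
      by eventually_elim (auto simp: exponential_density_def indicator_def)
  qed measurable
  finally show ?thesis .
qed

lemma integrable_path_length_law_iff:
  fixes f :: "real \<Rightarrow> real"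
  assumes [measurable]: "f \<in> borel_measurable borel"
  shows "integrable path_length_law f \<longleftrightarrow> set_integrable lborel {0<..} (\<lambda>t. exp (- t) * f t)"
proof -
  have "integrable path_length_law f \<longleftrightarrow> integrable lborel (\<lambda>t. exponential_density 1 t * f t)"
    unfolding path_length_law_def
    by (subst integrable_density) (auto simp: exponential_density_def)
  also have "\<dots> \<longleftrightarrow> set_integrable lborel {0<..} (\<lambda>t. exp (- t) * f t)"
    unfolding set_integrable_def
  proof (rule integrable_cong_AE)
    show "AE t in lborel. exponential_density 1 t * f t = indicat_real {0<..} t *\<^sub>R (exp (- t) * f t)"
      using AE_lborel_singleton[of "0::real"]
      by eventually_elim (auto simp: exponential_density_def indicator_def)
  qed measurable
  finally show ?thesis .
qed

text \<open>
  A photon travels further than any given distance with positive probability. This is the source of the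
  contraction.
\<close>

lemma measure_path_length_law_less_1: "measure path_length_law {..d} < 1"
proof -
  have "emeasure path_length_law {..d} = erlang_CDF 0 1 d"
    unfolding path_length_law_def by (rule emeasure_erlang_density) simp
  then show ?thesis
    by (auto simp: measure_def erlang_CDF_0)
qed

definition ray_avg :: "('a::euclidean_space \<Rightarrow> real) \<Rightarrow> 'a \<Rightarrow> 'a \<Rightarrow> real" where
  "ray_avg w x n = (LINT t|path_length_law. w (x - t *\<^sub>R n))"

definition nn_ray_avg :: "('a::euclidean_space \<Rightarrow> ennreal) \<Rightarrow> 'a \<Rightarrow> 'a \<Rightarrow> ennreal" where
  "nn_ray_avg w x n = (\<integral>\<^sup>+t. w (x - t *\<^sub>R n) \<partial>path_length_law)"

lemma measurable_ray_avg [measurable (raw)]: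
  assumes [measurable]: "w \<in> borel_measurable borel" "f \<in> borel_measurable M" "d \<in> borel_measurable M"
  shows "(\<lambda>p. ray_avg w (f p) (d p)) \<in> borel_measurable M"
  unfolding ray_avg_def by measurable

lemma measurable_nn_ray_avg [measurable (raw)]:
  assumes [measurable]: "w \<in> borel_measurable borel" "f \<in> borel_measurable M" "d \<in> borel_measurable M"
  shows "(\<lambda>p. nn_ray_avg w (f p) (d p)) \<in> borel_measurable M"
  unfolding nn_ray_avg_def by measurable

lemma nn_integral_lborel_translate:
  fixes f :: "'a::euclidean_space \<Rightarrow> ennreal"
  assumes [measurable]: "f \<in> borel_measurable borel"
  shows "(\<integral>\<^sup>+x. f (c + x) \<partial>lborel) = (\<integral>\<^sup>+x. f x \<partial>lborel)"
  by (subst (2) lborel_distr_plus[of c, symmetric]) (simp add: nn_integral_distr)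

lemma integral_lborel_translate:
  fixes f :: "'a::euclidean_space \<Rightarrow> real"
  assumes [measurable]: "f \<in> borel_measurable borel"
  shows "(LINT x|lborel. f (c + x)) = (LINT x|lborel. f x)"
  by (subst (2) lborel_distr_plus[of c, symmetric]) (simp add: integral_distr)

text \<open>
  Interchange the integrals and translate by \<open>t n\<close>, which preserves Lebesgue measure. The version for real
  functions differs only by the integrability needed to interchange.
\<close>

lemma nn_ray_avg_adjoint:
  fixes f h :: "'a::euclidean_space \<Rightarrow> ennreal"
  assumes [measurable]: "f \<in> borel_measurable borel" "h \<in> borel_measurable borel"
  shows "(\<integral>\<^sup>+x. nn_ray_avg f x n * h x \<partial>lborel) = (\<integral>\<^sup>+z. f z * nn_ray_avg h z (- n) \<partial>lborel)"
proof -
  have "(\<integral>\<^sup>+x. nn_ray_avg f x n * h x \<partial>lborel) =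
        (\<integral>\<^sup>+x. \<integral>\<^sup>+t. f (x - t *\<^sub>R n) * h x \<partial>path_length_law \<partial>lborel)"
    by (simp add: nn_ray_avg_def nn_integral_multc)
  also have "\<dots> = (\<integral>\<^sup>+t. \<integral>\<^sup>+x. f (x - t *\<^sub>R n) * h x \<partial>lborel \<partial>path_length_law)"
    by (rule lborel_path.Fubini'[symmetric]) measurable
  also have "\<dots> = (\<integral>\<^sup>+t. \<integral>\<^sup>+z. f z * h (z + t *\<^sub>R n) \<partial>lborel \<partial>path_length_law)"
  proof (rule nn_integral_cong)
    fix t
    show "(\<integral>\<^sup>+x. f (x - t *\<^sub>R n) * h x \<partial>lborel) = (\<integral>\<^sup>+z. f z * h (z + t *\<^sub>R n) \<partial>lborel)"
      using nn_integral_lborel_translate[of "\<lambda>x. f (x - t *\<^sub>R n) * h x" "t *\<^sub>R n"]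
      by (simp add: add.commute)
  qed
  also have "\<dots> = (\<integral>\<^sup>+z. \<integral>\<^sup>+t. f z * h (z + t *\<^sub>R n) \<partial>path_length_law \<partial>lborel)"
    by (rule lborel_path.Fubini') measurable
  finally show ?thesis
    by (simp add: nn_ray_avg_def nn_integral_cmult)
qed

lemma nn_integral_nn_ray_avg:
  fixes f :: "'a::euclidean_space \<Rightarrow> ennreal"
  assumes [measurable]: "f \<in> borel_measurable borel"
  shows "(\<integral>\<^sup>+x. nn_ray_avg f x n \<partial>lborel) = (\<integral>\<^sup>+x. f x \<partial>lborel)"
  using nn_ray_avg_adjoint[of f "\<lambda>_. 1" n]
  by (simp add: nn_ray_avg_def path_length.emeasure_space_1[simplified])

lemma ray_avg_adjoint:
  fixes w \<psi> :: "'a::euclidean_space \<Rightarrow> real"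
  assumes w: "integrable lborel w" and [measurable]: "\<psi> \<in> borel_measurable borel"
    and bound: "\<And>x. \<bar>\<psi> x\<bar> \<le> C"
  shows "integrable lborel (\<lambda>x. ray_avg w x n * \<psi> x)"
    and "(LINT x|lborel. ray_avg w x n * \<psi> x) = (LINT z|lborel. w z * ray_avg \<psi> z (- n))"
proof -
  have [measurable]: "w \<in> borel_measurable borel" using w by auto
  have C: "0 \<le> C" using bound[of 0] by linarith
  have fin: "(\<integral>\<^sup>+x. ennreal C * ennreal \<bar>w x\<bar> \<partial>lborel) < \<infinity>"
    using w by (auto simp: nn_integral_cmult integrable_iff_bounded ennreal_mult_less_top)
  have I1: "integrable (lborel \<Otimes>\<^sub>M path_length_law) (\<lambda>(x, t). w (x - t *\<^sub>R n) * \<psi> x)"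
  proof (rule integrableI_bounded)
    have "(\<integral>\<^sup>+p. norm (case p of (x, t) \<Rightarrow> w (x - t *\<^sub>R n) * \<psi> x) \<partial>(lborel \<Otimes>\<^sub>M path_length_law))
        = (\<integral>\<^sup>+x. \<integral>\<^sup>+t. norm (w (x - t *\<^sub>R n) * \<psi> x) \<partial>path_length_law \<partial>lborel)"
      by (subst path_length.nn_integral_fst[symmetric]) auto
    also have "\<dots> \<le> (\<integral>\<^sup>+x. nn_ray_avg (\<lambda>x. ennreal C * ennreal \<bar>w x\<bar>) x n \<partial>lborel)"
      unfolding nn_ray_avg_def
      by (intro nn_integral_mono)
         (auto simp: abs_mult mult.commute ennreal_mult'[symmetric] C intro!: ennreal_leI mult_right_mono bound)
    finally show "(\<integral>\<^sup>+p. norm (case p of (x, t) \<Rightarrow> w (x - t *\<^sub>R n) * \<psi> x) \<partial>(lborel \<Otimes>\<^sub>M path_length_law)) < \<infinity>"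
      using fin by (simp add: nn_integral_nn_ray_avg le_less_trans)
  qed measurable
  \<comment> \<open>The translated integrand, needed to interchange back after the change of variables.\<close>
  have I2: "integrable (lborel \<Otimes>\<^sub>M path_length_law) (\<lambda>(z, t). w z * \<psi> (z + t *\<^sub>R n))"
  proof (rule integrableI_bounded)
    have "(\<integral>\<^sup>+p. norm (case p of (z, t) \<Rightarrow> w z * \<psi> (z + t *\<^sub>R n)) \<partial>(lborel \<Otimes>\<^sub>M path_length_law))
        = (\<integral>\<^sup>+z. \<integral>\<^sup>+t. norm (w z * \<psi> (z + t *\<^sub>R n)) \<partial>path_length_law \<partial>lborel)"
      by (subst path_length.nn_integral_fst[symmetric]) auto
    also have "\<dots> \<le> (\<integral>\<^sup>+z. \<integral>\<^sup>+t. ennreal C * ennreal \<bar>w z\<bar> \<partial>path_length_law \<partial>lborel)"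
    proof (intro nn_integral_mono)
      fix z t
      have "\<bar>w z\<bar> * \<bar>\<psi> (z + t *\<^sub>R n)\<bar> \<le> C * \<bar>w z\<bar>"
        by (subst mult.commute) (intro mult_right_mono bound, simp)
      then show "ennreal (norm (w z * \<psi> (z + t *\<^sub>R n))) \<le> ennreal C * ennreal \<bar>w z\<bar>"
        by (simp add: abs_mult ennreal_mult'[symmetric] C ennreal_leI)
    qed
    finally show "(\<integral>\<^sup>+p. norm (case p of (z, t) \<Rightarrow> w z * \<psi> (z + t *\<^sub>R n)) \<partial>(lborel \<Otimes>\<^sub>M path_length_law)) < \<infinity>"
      using fin by (simp add: path_length.emeasure_space_1[simplified] le_less_trans)
  qed measurable
  show "integrable lborel (\<lambda>x. ray_avg w x n * \<psi> x)"
    using lborel_path.integrable_fst'[OF I1] by (simp add: ray_avg_def)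
  have "(LINT x|lborel. ray_avg w x n * \<psi> x) =
        (LINT x|lborel. LINT t|path_length_law. w (x - t *\<^sub>R n) * \<psi> x)"
    by (simp add: ray_avg_def)
  also have "\<dots> = (LINT t|path_length_law. LINT x|lborel. w (x - t *\<^sub>R n) * \<psi> x)"
    using lborel_path.Fubini_integral[OF I1] by simp
  also have "\<dots> = (LINT t|path_length_law. LINT z|lborel. w z * \<psi> (z + t *\<^sub>R n))"
  proof (rule Bochner_Integration.integral_cong[OF refl])
    fix t
    show "(LINT x|lborel. w (x - t *\<^sub>R n) * \<psi> x) = (LINT z|lborel. w z * \<psi> (z + t *\<^sub>R n))"
      using integral_lborel_translate[of "\<lambda>x. w (x - t *\<^sub>R n) * \<psi> x" "t *\<^sub>R n"]
      by (simp add: add.commute)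
  qed
  also have "\<dots> = (LINT z|lborel. LINT t|path_length_law. w z * \<psi> (z + t *\<^sub>R n))"
    using lborel_path.Fubini_integral[OF I2] by simp
  also have "\<dots> = (LINT z|lborel. w z * ray_avg \<psi> z (- n))"
    by (simp add: ray_avg_def)
  finally show "(LINT x|lborel. ray_avg w x n * \<psi> x) = (LINT z|lborel. w z * ray_avg \<psi> z (- n))" .
qed

text \<open>
  On the ray \<open>t \<mapsto> z + t n\<close> the function \<open>exp(-t) (D(z + t n) n - \<phi>(z + t n))\<close> is the derivative of
  \<open>exp(-t) \<phi>(z + t n)\<close>, which runs from \<open>\<phi> z\<close> at 0 to 0 at infinity.
\<close>

lemma ray_avg_directional_derivative:
  fixes \<phi> :: "'a::euclidean_space \<Rightarrow> real"
  assumes D: "\<And>x. (\<phi> has_derivative D x) (at x)"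
    and cont: "continuous_on UNIV (\<lambda>x. D x n)"
    and b\<phi>: "\<And>x. \<bar>\<phi> x\<bar> \<le> C" and bD: "\<And>x. \<bar>D x n\<bar> \<le> C'"
  shows "ray_avg (\<lambda>x. D x n) z (- n) = ray_avg \<phi> z (- n) - \<phi> z"
proof -
  have c\<phi>: "continuous_on UNIV \<phi>"
    by (intro continuous_at_imp_continuous_on ballI has_derivative_continuous[OF D])
  have [measurable]: "\<phi> \<in> borel_measurable borel" "(\<lambda>x. D x n) \<in> borel_measurable borel"
    using c\<phi> cont by (auto intro: borel_measurable_continuous_onI)
  define G where "G t = exp (- t) * \<phi> (z + t *\<^sub>R n)" for t
  define g where "g t = exp (- t) * (D (z + t *\<^sub>R n) n - \<phi> (z + t *\<^sub>R n))" for t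
  have i\<phi>: "integrable path_length_law (\<lambda>t. \<phi> (z + t *\<^sub>R n))"
    by (rule path_length.integrable_const_bound[where B = C]) (auto simp: b\<phi>)
  have iD: "integrable path_length_law (\<lambda>t. D (z + t *\<^sub>R n) n)"
    by (rule path_length.integrable_const_bound[where B = C']) (auto simp: bD)
  have "set_integrable lborel {0<..} g"
    unfolding g_def using i\<phi> iD
    by (subst integrable_path_length_law_iff[symmetric]) auto
  then have "(LBINT t=0..\<infinity>. g t) = 0 - \<phi> z"
  proof (intro interval_integral_FTC_integrable[where F = G])
    show "(G has_vector_derivative g t) (at t)" for t
    proof -
      have "((\<lambda>t. \<phi> (z + t *\<^sub>R n)) has_derivative (\<lambda>s. D (z + t *\<^sub>R n) (s *\<^sub>R n))) (at t)"
      proof (rule has_derivative_compose[where g = \<phi>, OF _ D])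
        have "((\<lambda>t. z + t *\<^sub>R n) has_derivative (\<lambda>s. 0 + s *\<^sub>R n)) (at t)"
          by (intro has_derivative_add has_derivative_const has_derivative_scaleR_left has_derivative_ident)
        then show "((\<lambda>t. z + t *\<^sub>R n) has_derivative (\<lambda>s. s *\<^sub>R n)) (at t)"
          by simp
      qed
      then have "((\<lambda>t. \<phi> (z + t *\<^sub>R n)) has_field_derivative D (z + t *\<^sub>R n) n) (at t)"
        by (simp add: has_field_derivative_def linear_cmul[OF has_derivative_linear[OF D]] mult_commute_abs)
      then have "(G has_field_derivative g t) (at t)"
        unfolding G_def g_def by (auto intro!: derivative_eq_intros simp: algebra_simps)
      then show ?thesis by (simp add: has_real_derivative_iff_has_vector_derivative)
    qed
    have line: "isCont (\<lambda>t. z + t *\<^sub>R n) t" for t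
      by (intro continuous_intros)
    have c1: "isCont (\<lambda>t. \<phi> (z + t *\<^sub>R n)) t" for t
      by (rule isCont_o2[OF line]) (use c\<phi> in \<open>auto simp: continuous_on_eq_continuous_at\<close>)
    have c2: "isCont (\<lambda>t. D (z + t *\<^sub>R n) n) t" for t
      by (rule isCont_o2[OF line, where g = "\<lambda>x. D x n"])
         (use cont in \<open>auto simp: continuous_on_eq_continuous_at\<close>)
    have c3: "isCont (\<lambda>t::real. exp (- t)) t" for t
      by (intro continuous_intros)
    show "isCont g t" for t
      unfolding g_def by (intro isCont_mult isCont_diff c1 c2 c3)
    have "isCont G 0"
      unfolding G_def by (intro isCont_mult c1 c3)
    then have "(G \<longlongrightarrow> \<phi> z) (at_right 0)"
      by (auto simp: isCont_def G_def filterlim_at_split)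
    then show "((G \<circ> real_of_ereal) \<longlongrightarrow> \<phi> z) (at_right 0)"
      unfolding zero_ereal_def by (simp only: ereal_tendsto_simps)
    have "((\<lambda>t. C * exp (- t)) \<longlongrightarrow> C * 0) at_top"
      by (intro tendsto_intros filterlim_compose[OF exp_at_bot] filterlim_uminus_at_bot_at_top)
    then have "(G \<longlongrightarrow> 0) at_top"
      by (rule Lim_null_comparison[rotated, OF tendsto_eq_rhs])
         (auto simp: G_def abs_mult b\<phi> mult.commute intro!: always_eventually mult_right_mono)
    then show "((G \<circ> real_of_ereal) \<longlongrightarrow> 0) (at_left \<infinity>)"
      by (simp add: ereal_tendsto_simps)
  qed (auto simp: einterval_def greaterThan_def)
  moreover have "(LBINT t=0..\<infinity>. g t) = (LINT t:{0<..}|lborel. g t)"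
    by (simp add: interval_lebesgue_integral_def einterval_def greaterThan_def)
  moreover have "\<dots> = (LINT t|path_length_law. D (z + t *\<^sub>R n) n - \<phi> (z + t *\<^sub>R n))"
    unfolding g_def by (subst integral_path_length_law) auto
  moreover have "\<dots> = ray_avg (\<lambda>x. D x n) z (- n) - ray_avg \<phi> z (- n)"
    using i\<phi> iD by (simp add: ray_avg_def)
  ultimately show ?thesis by simp
qed

text \<open>
  The weak form of \<open>n \<cdot> \<nabla>I = w - I\<close> for \<open>I = ray_avg w \<cdot> n\<close>: move the average to the test function, where
  the derivative can be integrated along the ray.
\<close>

lemma transport_weak_form:
  fixes \<phi> w :: "'a::euclidean_space \<Rightarrow> real"
  assumes D: "\<And>x. (\<phi> has_derivative D x) (at x)"
    and cont: "continuous_on UNIV (\<lambda>x. D x n)"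
    and b\<phi>: "\<And>x. \<bar>\<phi> x\<bar> \<le> C" and bD: "\<And>x. \<bar>D x n\<bar> \<le> C'"
    and w: "integrable lborel w"
  shows "(LINT x|lborel. ray_avg w x n * D x n) =
         (LINT x|lborel. ray_avg w x n * \<phi> x) - (LINT x|lborel. w x * \<phi> x)"
proof -
  have c\<phi>: "continuous_on UNIV \<phi>"
    by (intro continuous_at_imp_continuous_on ballI has_derivative_continuous[OF D])
  have [measurable]: "\<phi> \<in> borel_measurable borel" "(\<lambda>x. D x n) \<in> borel_measurable borel"
    using c\<phi> cont by (auto intro: borel_measurable_continuous_onI)
  have [measurable]: "w \<in> borel_measurable borel" using w by auto
  have C: "0 \<le> C" using b\<phi>[of 0] by linarith
  have b: "\<bar>ray_avg \<phi> z (- n)\<bar> \<le> C" for z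
  proof -
    have "\<bar>LINT t|path_length_law. \<phi> (z + t *\<^sub>R n)\<bar> \<le> (LINT t|path_length_law. \<bar>\<phi> (z + t *\<^sub>R n)\<bar>)"
      by (rule integral_abs_bound)
    also have "\<dots> \<le> C"
      by (intro path_length.integral_le_const path_length.integrable_const_bound[where B = C])
         (auto simp: b\<phi>)
    finally have "\<bar>LINT t|path_length_law. \<phi> (z - t *\<^sub>R (- n))\<bar> \<le> C" by simp
    then show ?thesis by (simp add: ray_avg_def)
  qed
  have iw: "integrable lborel (\<lambda>z. w z * f z)"
    if [measurable]: "f \<in> borel_measurable borel" and "\<And>z. \<bar>f z\<bar> \<le> C" for f
    by (rule Bochner_Integration.integrable_bound[of _ "\<lambda>z. C * norm (w z)"])
       (use w that C in \<open>auto simp: abs_mult mult.commute intro!: AE_I2 mult_right_mono\<close>)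
  have "(LINT x|lborel. ray_avg w x n * D x n) = (LINT z|lborel. w z * ray_avg (\<lambda>x. D x n) z (- n))"
    by (rule ray_avg_adjoint(2)[OF w _ bD]) measurable
  also have "\<dots> = (LINT z|lborel. w z * ray_avg \<phi> z (- n) - w z * \<phi> z)"
    by (simp add: ray_avg_directional_derivative[OF D cont b\<phi> bD] right_diff_distrib)
  also have "\<dots> = (LINT z|lborel. w z * ray_avg \<phi> z (- n)) - (LINT z|lborel. w z * \<phi> z)"
    by (intro Bochner_Integration.integral_diff iw b b\<phi>) measurable
  also have "(LINT z|lborel. w z * ray_avg \<phi> z (- n)) = (LINT x|lborel. ray_avg w x n * \<phi> x)"
    by (rule ray_avg_adjoint(2)[OF w _ b\<phi>, symmetric]) measurable
  finally show ?thesis .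
qed

text \<open>
  Averaging along a ray preserves the total integral, and by the preceding identity the average of the
  derivative is the difference of an average of \<open>\<phi>\<close> and \<open>\<phi>\<close> itself.
\<close>

lemma integral_directional_derivative_zero:
  fixes \<phi> :: "'a::euclidean_space \<Rightarrow> real"
  assumes D: "\<And>x. (\<phi> has_derivative D x) (at x)"
    and cont: "continuous_on UNIV (\<lambda>x. D x n)"
    and b\<phi>: "\<And>x. \<bar>\<phi> x\<bar> \<le> C" and bD: "\<And>x. \<bar>D x n\<bar> \<le> C'"
    and i\<phi>: "integrable lborel \<phi>" and iD: "integrable lborel (\<lambda>x. D x n)"
  shows "(LINT x|lborel. D x n) = 0"
proof -
  have total: "integrable lborel (\<lambda>x. ray_avg w x (- n))"
      "(LINT x|lborel. ray_avg w x (- n)) = (LINT x|lborel. w x)"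
    if "integrable lborel w" for w :: "'a \<Rightarrow> real"
    using ray_avg_adjoint[OF that, of "\<lambda>_. 1" 1 "- n"]
    by (auto simp: ray_avg_def path_length.prob_space[simplified])
  have "(LINT x|lborel. D x n) = (LINT x|lborel. ray_avg \<phi> x (- n) - \<phi> x)"
    by (simp add: total(2)[OF iD, symmetric] ray_avg_directional_derivative[OF D cont b\<phi> bD])
  also have "\<dots> = 0"
    using total[OF i\<phi>] i\<phi> by simp
  finally show ?thesis .
qed

section \<open>Rays in a convex body\<close>

text \<open>
  The first boundary point on the ray is the only one: if the ray came back to the closure, the segment
  to that later point would lie in the interior, by convexity, but it contains the first boundary point.
\<close>

lemma ray_leaves_convex_once:
  fixes \<Omega> :: "'a::euclidean_space set"
  assumes "open \<Omega>" "convex \<Omega>" "bounded \<Omega>" "x \<in> \<Omega>" "n \<noteq> 0"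
  obtains s where "s > 0" "x - s *\<^sub>R n \<in> frontier \<Omega>"
    "\<And>t. 0 \<le> t \<Longrightarrow> x - t *\<^sub>R n \<in> \<Omega> \<longleftrightarrow> t < s"
    "\<And>t. 0 < t \<Longrightarrow> x - t *\<^sub>R n \<in> frontier \<Omega> \<Longrightarrow> t = s"
proof -
  have int: "interior \<Omega> = \<Omega>" using assms(1) by (rule interior_open)
  obtain s where s: "0 < s" "x + s *\<^sub>R (- n) \<in> frontier \<Omega>"
      "\<And>e. 0 \<le> e \<Longrightarrow> e < s \<Longrightarrow> x + e *\<^sub>R (- n) \<in> interior \<Omega>"
    using ray_to_frontier[OF assms(3), of x "- n"] assms(4,5) unfolding int neg_equal_0_iff_equal by metis
  have beyond: "x - t *\<^sub>R n \<notin> closure \<Omega>" if "s < t" for t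
  proof
    assume "x - t *\<^sub>R n \<in> closure \<Omega>"
    then have "open_segment x (x - t *\<^sub>R n) \<subseteq> interior \<Omega>"
      using assms int by (intro in_interior_closure_convex_segment) auto
    moreover have "x - s *\<^sub>R n \<in> open_segment x (x - t *\<^sub>R n)"
      unfolding in_segment
    proof (intro conjI exI)
      show "x - s *\<^sub>R n = (1 - s / t) *\<^sub>R x + (s / t) *\<^sub>R (x - t *\<^sub>R n)"
        using that s(1) by (simp add: algebra_simps)
    qed (use that s(1) assms(5) in auto)
    ultimately show False using s(2) by (auto simp: frontier_def)
  qed
  show ?thesis
  proof (rule that[OF s(1)])
    show "x - s *\<^sub>R n \<in> frontier \<Omega>" using s(2) by simp
    have inside: "x - t *\<^sub>R n \<in> \<Omega>" if "0 \<le> t" "t < s" for t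
      using s(3)[OF that] int by simp
    have at_s: "x - s *\<^sub>R n \<notin> \<Omega>"
      using s(2) int by (simp add: frontier_def)
    fix t :: real
    show "x - t *\<^sub>R n \<in> \<Omega> \<longleftrightarrow> t < s" if "0 \<le> t"
    proof (cases t s rule: linorder_cases)
      case less
      with inside[OF that] show ?thesis by blast
    next
      case equal
      with at_s show ?thesis by simp
    next
      case greater
      have "x - t *\<^sub>R n \<notin> \<Omega>"
        using beyond[OF greater] closure_subset by blast
      with greater show ?thesis by simp
    qed
    show "t = s" if "0 < t" "x - t *\<^sub>R n \<in> frontier \<Omega>"
    proof (cases t s rule: linorder_cases)
      case less
      with inside[of t] that int show ?thesis by (simp add: frontier_def)
    next
      case greater
      with beyond[OF greater] that show ?thesis by (simp add: frontier_def)
    qed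
  qed
qed

lemma entry_dist_props:
  assumes "open \<Omega>" "convex \<Omega>" "bounded \<Omega>" "x \<in> \<Omega>" "norm n = 1"
  shows "entry_dist \<Omega> x n > 0"
    and "entry_point \<Omega> x n = x - entry_dist \<Omega> x n *\<^sub>R n"
    and "\<And>t. 0 \<le> t \<Longrightarrow> x - t *\<^sub>R n \<in> \<Omega> \<longleftrightarrow> t < entry_dist \<Omega> x n"
proof -
  have "n \<noteq> 0" using assms(5) by auto
  then obtain s where s: "s > 0" "x - s *\<^sub>R n \<in> frontier \<Omega>"
    "\<And>t. 0 \<le> t \<Longrightarrow> x - t *\<^sub>R n \<in> \<Omega> \<longleftrightarrow> t < s"
    "\<And>t. 0 < t \<Longrightarrow> x - t *\<^sub>R n \<in> frontier \<Omega> \<Longrightarrow> t = s"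
    using ray_leaves_convex_once[OF assms(1-4)] by metis
  have e: "entry_point \<Omega> x n = x - s *\<^sub>R n"
    unfolding entry_point_def
  proof (rule the_equality)
    show "x - s *\<^sub>R n \<in> frontier \<Omega> \<and> (\<exists>t>0. x - s *\<^sub>R n = x - t *\<^sub>R n)"
      using s(1,2) by blast
    show "y = x - s *\<^sub>R n" if "y \<in> frontier \<Omega> \<and> (\<exists>t>0. y = x - t *\<^sub>R n)" for y
      using that s(4) by blast
  qed
  then have "entry_dist \<Omega> x n = s"
    using s(1) assms(5) by (simp add: entry_dist_def)
  with e s(1,3) show "entry_dist \<Omega> x n > 0" "entry_point \<Omega> x n = x - entry_dist \<Omega> x n *\<^sub>R n"
    "\<And>t. 0 \<le> t \<Longrightarrow> x - t *\<^sub>R n \<in> \<Omega> \<longleftrightarrow> t < entry_dist \<Omega> x n" by simp_all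
qed

lemma AE_path_length_neq: "AE t in path_length_law. t \<noteq> s"
  unfolding path_length_law_def
  using AE_lborel_singleton[of s] by (subst AE_density) auto

text \<open>
  Followed backwards from \<open>x\<close>, a path of exponential length stays in \<open>\<Omega>\<close> exactly if it is shorter than the
  distance to the boundary. This makes the attenuation factor a ray average, and in particular jointly
  measurable in \<open>x\<close> and \<open>n\<close>.
\<close>

lemma exp_entry_dist:
  assumes "open \<Omega>" "convex \<Omega>" "bounded \<Omega>" "x \<in> \<Omega>" "norm n = 1"
  shows "exp (- entry_dist \<Omega> x n) = 1 - ray_avg (indicat_real \<Omega>) x n"
proof -
  let ?s = "entry_dist \<Omega> x n"
  note e = entry_dist_props[OF assms]
  have [measurable]: "\<Omega> \<in> sets borel" using assms(1) by auto
  have "ray_avg (indicat_real \<Omega>) x n = (LINT t|path_length_law. indicat_real {..?s} t)"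
    unfolding ray_avg_def
  proof (rule integral_cong_AE)
    show "AE t in path_length_law. indicat_real \<Omega> (x - t *\<^sub>R n) = indicat_real {..?s} t"
      using AE_path_length_pos AE_path_length_neq[of ?s]
      by eventually_elim (use e(3) in \<open>auto simp: indicator_def\<close>)
  qed measurable
  also have "\<dots> = measure path_length_law {..?s}" by simp
  also have "\<dots> = 1 - exp (- ?s)"
    unfolding path_length_law_def measure_def
    using e(1) by (subst emeasure_erlang_density) (auto simp: erlang_CDF_0)
  finally show ?thesis by simp
qed

section \<open>Planck's law\<close>

lemma planck_0 [simp]: "planck h c k \<nu> 0 = 0"
  by (simp add: planck_def)

lemma planck_nonneg: "h > 0 \<Longrightarrow> k > 0 \<Longrightarrow> \<nu> > 0 \<Longrightarrow> T \<ge> 0 \<Longrightarrow> planck h c k \<nu> T \<ge> 0"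
  unfolding planck_def
  by (intro mult_nonneg_nonneg divide_nonneg_nonneg zero_le_power zero_le_power2)
     (simp_all add: divide_nonneg_nonneg)

lemma measurable_planck [measurable (raw)]:
  assumes [measurable]: "f \<in> borel_measurable M" "T \<in> borel_measurable M"
  shows "(\<lambda>p. planck h c k (f p) (T p)) \<in> borel_measurable M"
  unfolding planck_def by measurable

text \<open>
  The substitution \<open>t = s - \<xi>\<close> measures the distance from \<open>x\<close> backwards. Cutting the temperature off outside
  \<open>\<Omega>\<close> then encodes the upper limit \<open>s\<close> of the integral, because \<open>planck\<close> vanishes at temperature 0.
\<close>

lemma intensity_eq_ray_avg:
  assumes \<Omega>: "open \<Omega>" "convex \<Omega>" "bounded \<Omega>" "x \<in> \<Omega>" "norm n = 1"
    and [measurable]: "(\<lambda>z. indicat_real \<Omega> z * T z) \<in> borel_measurable borel"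
  shows "intensity h c k \<Omega> g T \<nu> x n =
     g \<nu> n * (1 - ray_avg (indicat_real \<Omega>) x n) +
     ray_avg (\<lambda>z. planck h c k \<nu> (indicat_real \<Omega> z * T z)) x n"
proof -
  let ?s = "entry_dist \<Omega> x n"
  note e = entry_dist_props[OF \<Omega>]
  let ?P = "\<lambda>z. planck h c k \<nu> (indicat_real \<Omega> z * T z)"
  have "(LINT \<xi>:{0<..<?s}|lborel. exp (- (?s - \<xi>)) * planck h c k \<nu> (T (x - ?s *\<^sub>R n + \<xi> *\<^sub>R n))) =
        (LINT t|lborel. indicat_real {0<..<?s} (?s + (-1) * t) *\<^sub>R
           (exp (- (?s - (?s + (-1) * t))) * planck h c k \<nu> (T (x - ?s *\<^sub>R n + (?s + (-1) * t) *\<^sub>R n))))"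
    unfolding set_lebesgue_integral_def
    by (subst lborel_integral_real_affine[where c = "-1" and t = ?s]) auto
  also have "\<dots> = (LINT t:{0<..}|lborel. exp (- t) * ?P (x - t *\<^sub>R n))"
    unfolding set_lebesgue_integral_def
  proof (intro Bochner_Integration.integral_cong refl)
    fix t
    show "indicat_real {0<..<?s} (?s + (-1) * t) *\<^sub>R
           (exp (- (?s - (?s + (-1) * t))) * planck h c k \<nu> (T (x - ?s *\<^sub>R n + (?s + (-1) * t) *\<^sub>R n)))
        = indicat_real {0<..} t *\<^sub>R (exp (- t) * ?P (x - t *\<^sub>R n))"
      using e(3)[of t] by (auto simp: indicator_def algebra_simps)
  qed
  also have "\<dots> = ray_avg ?P x n"
    unfolding ray_avg_def by (subst integral_path_length_law) auto
  finally show ?thesis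
    unfolding intensity_def Let_def exp_entry_dist[OF \<Omega>] e(2) by simp
qed

text \<open>
  The factor \<open>\<sigma>\<close> in the law \<open>\<integral> B\<^sub>\<nu>(T) d\<nu> = \<sigma> T\<^sup>4\<close>.
\<close>

definition radiation_constant :: "real \<Rightarrow> real \<Rightarrow> real \<Rightarrow> real" where
  "radiation_constant h c k = enn2real (\<integral>\<^sup>+\<nu>\<in>{0<..}. ennreal (planck h c k \<nu> 1) \<partial>lborel)"

text \<open>
  With \<open>y = a \<nu>\<close>, the bound \<open>1 + y \<le> exp y\<close> gives \<open>1 / (exp y - 1) \<le> (1 + y) / (y exp y)\<close>, so the Planck
  density lies below a combination of two Gamma densities, which have total mass 1.
\<close>

lemma nn_integral_planck_1_finite:
  assumes "h > 0" "c > 0" "k > 0"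
  shows "(\<integral>\<^sup>+\<nu>\<in>{0<..}. ennreal (planck h c k \<nu> 1) \<partial>lborel) < \<infinity>"
proof -
  define a where "a = h / k"
  have a: "a > 0" using assms by (simp add: a_def)
  define C where "C = 2 * h / (c\<^sup>2 * a)"
  have C: "C > 0" using assms a by (simp add: C_def)
  have bound: "planck h c k \<nu> 1 \<le> C * 2 / a ^ 3 * erlang_density 2 a \<nu> + C * 6 / a ^ 3 * erlang_density 3 a \<nu>"
    if \<nu>: "\<nu> > 0" for \<nu>
  proof -
    \<comment> \<open>Equivalent to \<open>1 + a \<nu> \<le> exp (a \<nu>)\<close> after expanding.\<close>
    have "(exp (a * \<nu>) - 1) * (1 + a * \<nu>) \<ge> a * \<nu> * exp (a * \<nu>)"
      using exp_ge_add_one_self[of "a * \<nu>"] by (simp add: algebra_simps)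
    moreover have "exp (a * \<nu>) - 1 > 0" using a \<nu> by simp
    ultimately have "1 / (exp (a * \<nu>) - 1) \<le> (1 + a * \<nu>) / (a * \<nu> * exp (a * \<nu>))"
      using a \<nu> by (simp add: field_simps)
    then have "2 * h * \<nu> ^ 3 / c\<^sup>2 * (1 / (exp (a * \<nu>) - 1)) \<le>
        2 * h * \<nu> ^ 3 / c\<^sup>2 * ((1 + a * \<nu>) / (a * \<nu> * exp (a * \<nu>)))"
      using assms \<nu> by (intro mult_left_mono) auto
    also have "\<dots> = C * \<nu>\<^sup>2 * exp (- (a * \<nu>)) + C * a * \<nu> ^ 3 * exp (- (a * \<nu>))"
      using a \<nu> assms unfolding C_def by (simp add: field_simps exp_minus power2_eq_square power3_eq_cube)
    also have "\<dots> = C * 2 / a ^ 3 * erlang_density 2 a \<nu> + C * 6 / a ^ 3 * erlang_density 3 a \<nu>"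
      using a \<nu> by (simp add: erlang_density_def fact_numeral field_simps power_numeral_reduce)
    finally show ?thesis by (simp add: planck_def a_def)
  qed
  have one: "(\<integral>\<^sup>+\<nu>. ennreal (erlang_density m a \<nu>) \<partial>lborel) = 1" for m
    using prob_space.emeasure_space_1[OF prob_space_erlang_density[OF a, of m]]
    by (simp add: emeasure_density)
  have "(\<integral>\<^sup>+\<nu>\<in>{0<..}. ennreal (planck h c k \<nu> 1) \<partial>lborel) \<le>
     (\<integral>\<^sup>+\<nu>. ennreal (C * 2 / a ^ 3) * ennreal (erlang_density 2 a \<nu>)
            + ennreal (C * 6 / a ^ 3) * ennreal (erlang_density 3 a \<nu>) \<partial>lborel)"
  proof (intro nn_integral_mono)
    fix \<nu>
    have nn: "0 \<le> erlang_density m a \<nu>" for m using a by simp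
    show "ennreal (planck h c k \<nu> 1) * indicator {0<..} \<nu> \<le>
       ennreal (C * 2 / a ^ 3) * ennreal (erlang_density 2 a \<nu>)
            + ennreal (C * 6 / a ^ 3) * ennreal (erlang_density 3 a \<nu>)"
      using bound[of \<nu>] a C nn
      by (cases "\<nu> > 0") (auto simp: ennreal_mult'[symmetric] ennreal_plus[symmetric] intro!: ennreal_leI simp del: ennreal_plus)
  qed
  also have "\<dots> = ennreal (C * 2 / a ^ 3) + ennreal (C * 6 / a ^ 3)"
    by (simp add: nn_integral_add nn_integral_cmult one)
  also have "\<dots> < \<infinity>" by simp
  finally show ?thesis .
qed

lemma radiation_constant_pos:
  assumes "h > 0" "c > 0" "k > 0"
  shows "radiation_constant h c k > 0"
proof -
  have "(\<integral>\<^sup>+\<nu>\<in>{0<..}. ennreal (planck h c k \<nu> 1) \<partial>lborel) \<noteq> 0"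
  proof
    assume "(\<integral>\<^sup>+\<nu>\<in>{0<..}. ennreal (planck h c k \<nu> 1) \<partial>lborel) = 0"
    then have "AE \<nu> in lborel. ennreal (planck h c k \<nu> 1) * indicator {0<..} \<nu> = 0"
      by (subst (asm) nn_integral_0_iff_AE) auto
    then have "AE \<nu> in lborel. \<not> (\<nu> \<in> {0<..<1::real})"
    proof eventually_elim
      case (elim \<nu>)
      have "planck h c k \<nu> 1 > 0" if "\<nu> > 0"
        using assms that by (auto simp: planck_def intro!: divide_pos_pos mult_pos_pos)
      with elim show ?case by (auto simp: indicator_def ennreal_eq_0_iff split: if_splits)
    qed
    then have "{0<..<1::real} \<in> null_sets lborel"
      by (subst AE_iff_null_sets) auto
    then show False by (simp add: null_sets_def)
  qed
  then show ?thesis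
    using nn_integral_planck_1_finite[OF assms]
    unfolding radiation_constant_def by (subst enn2real_positive_iff) (simp add: zero_less_iff_neq_zero)
qed

text \<open>
  Substituting \<open>T \<nu>\<close> for \<open>\<nu>\<close> yields a factor \<open>T\<^sup>3\<close> from the integrand and a factor \<open>T\<close> from the measure.
\<close>

lemma nn_integral_planck:
  assumes "h > 0" "c > 0" "k > 0" "T \<ge> 0"
  shows "(\<integral>\<^sup>+\<nu>\<in>{0<..}. ennreal (planck h c k \<nu> T) \<partial>lborel) = ennreal (radiation_constant h c k * T ^ 4)"
proof (cases "T = 0")
  case False
  with assms have T: "T > 0" by simp
  have scale: "planck h c k (T * \<nu>) T = T ^ 3 * planck h c k \<nu> 1" for \<nu>
    using T by (simp add: planck_def power_mult_distrib mult.commute mult.left_commute)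
  have "(\<integral>\<^sup>+\<nu>\<in>{0<..}. ennreal (planck h c k \<nu> T) \<partial>lborel) =
        ennreal T * (\<integral>\<^sup>+\<nu>. ennreal (planck h c k (T * \<nu>) T) * indicator {0<..} (T * \<nu>) \<partial>lborel)"
    using T nn_integral_real_affine[of "\<lambda>\<nu>. ennreal (planck h c k \<nu> T) * indicator {0<..} \<nu>" T 0]
    by simp
  also have "(\<integral>\<^sup>+\<nu>. ennreal (planck h c k (T * \<nu>) T) * indicator {0<..} (T * \<nu>) \<partial>lborel) =
      (\<integral>\<^sup>+\<nu>. ennreal (T ^ 3) * (ennreal (planck h c k \<nu> 1) * indicator {0<..} \<nu>) \<partial>lborel)"
    using T by (intro nn_integral_cong)
      (auto simp: scale ennreal_mult' indicator_def zero_less_mult_iff)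
  also have "\<dots> = ennreal (T ^ 3) * ennreal (radiation_constant h c k)"
    using nn_integral_planck_1_finite[OF assms(1-3)]
    by (subst nn_integral_cmult) (auto simp: radiation_constant_def)
  finally show ?thesis
    using T radiation_constant_pos[OF assms(1-3)]
    by (simp add: ennreal_mult'[symmetric] power_numeral_reduce mult.commute mult.left_commute)
qed simp

section \<open>The sphere of directions\<close>

text \<open>
  The same surface measure, but on the Borel sets of the whole space: the integrands below are defined
  and measurable for all direction vectors, so no restriction to the sphere is carried along.
\<close>

definition sphere_borel :: "(real^3) measure" where
  "sphere_borel = distr sphere_measure borel (\<lambda>n. n)"

lemma sgn_measurable_sphere:
  "sgn \<in> measurable (scale_measure 3 (restrict_space lborel (ball 0 1 - {0 :: real^3})))
           (restrict_space borel (sphere 0 1))"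
proof (rule measurable_restrict_space2)
  show "sgn \<in> space (scale_measure 3 (restrict_space lborel (ball 0 1 - {0 :: real^3}))) \<rightarrow> sphere 0 1"
    by (auto simp: space_scale_measure space_restrict_space norm_sgn)
  have "(sgn :: real^3 \<Rightarrow> real^3) \<in> borel_measurable borel"
    unfolding sgn_div_norm[abs_def] by measurable
  then have "sgn \<in> borel_measurable (restrict_space lborel (ball 0 1 - {0 :: real^3}))"
    by (intro measurable_restrict_space1) simp
  then show "sgn \<in> borel_measurable (scale_measure 3 (restrict_space lborel (ball 0 1 - {0 :: real^3})))"
    by (simp add: measurable_cong_sets[OF sets_scale_measure refl])
qed

lemma space_sphere_measure: "space sphere_measure = sphere 0 1"
  by (simp add: sphere_measure_def space_restrict_space)

lemma sets_sphere_measure: "sets sphere_measure = sets (restrict_space borel (sphere 0 1))"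
  by (simp add: sphere_measure_def)

lemma measurable_sphere_measure: "(\<lambda>n. n) \<in> borel_measurable sphere_measure"
  by (subst measurable_cong_sets[OF sets_sphere_measure refl]) (rule measurable_restrict_space1, simp)

lemma sets_sphere_borel [measurable_cong, simp]: "sets sphere_borel = sets borel"
  by (simp add: sphere_borel_def)

lemma space_sphere_borel [simp]: "space sphere_borel = UNIV"
  by (simp add: sphere_borel_def)

lemma emeasure_sphere_borel_UNIV:
  "emeasure sphere_borel UNIV = 3 * emeasure lborel (ball 0 1 - {0 :: real^3})"
proof -
  have "emeasure sphere_borel UNIV = emeasure sphere_measure (sphere 0 1)"
    unfolding sphere_borel_def by (subst emeasure_distr) (auto simp: space_sphere_measure measurable_sphere_measure)
  also have "\<dots> = emeasure (scale_measure 3 (restrict_space lborel (ball 0 1 - {0 :: real^3})))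
       (sgn -` sphere 0 1 \<inter> space (scale_measure 3 (restrict_space lborel (ball 0 1 - {0 :: real^3}))))"
    unfolding sphere_measure_def
    by (rule emeasure_distr[OF sgn_measurable_sphere]) (auto simp: sets_restrict_space)
  also have "sgn -` sphere 0 1 \<inter> space (scale_measure 3 (restrict_space lborel (ball 0 1 - {0 :: real^3}))) = ball 0 1 - {0}"
    by (auto simp: space_scale_measure space_restrict_space norm_sgn)
  finally show ?thesis
    by (simp add: emeasure_restrict_space)
qed

lemma emeasure_sphere_borel_bounds:
  "emeasure sphere_borel UNIV < \<infinity>" "emeasure sphere_borel UNIV > 0"
proof -
  have "emeasure lborel (ball 0 1 - {0 :: real^3}) \<le> emeasure lborel (ball 0 1 :: (real^3) set)"
    by (intro emeasure_mono) auto
  also have "\<dots> < \<infinity>" by (rule emeasure_bounded_finite) simp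
  finally show "emeasure sphere_borel UNIV < \<infinity>"
    by (simp add: emeasure_sphere_borel_UNIV ennreal_mult_less_top)
  have "emeasure lborel (ball 0 1 - {0 :: real^3}) \<noteq> 0"
  proof
    assume "emeasure lborel (ball 0 1 - {0 :: real^3}) = 0"
    then have "ball 0 1 - {0 :: real^3} \<in> null_sets lborel" by (simp add: null_sets_def)
    then have "negligible (ball 0 1 - {0 :: real^3})"
      by (simp add: negligible_iff_null_sets null_sets_completionI)
    moreover have "ball 0 1 = insert (0 :: real^3) (ball 0 1 - {0})" by auto
    ultimately have "negligible (ball (0 :: real^3) 1)" by (metis negligible_insert)
    then show False using open_not_negligible[of "ball (0 :: real^3) 1"] by simp
  qed
  then show "emeasure sphere_borel UNIV > 0"
    by (simp add: emeasure_sphere_borel_UNIV zero_less_iff_neq_zero)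
qed

interpretation sphere_borel: finite_measure sphere_borel
  using emeasure_sphere_borel_bounds by (intro finite_measureI) auto

interpretation lborel_sphere: pair_sigma_finite "lborel :: (real^3) measure" sphere_borel ..

lemma AE_sphere_borel_norm: "AE n in sphere_borel. norm n = 1"
  unfolding sphere_borel_def
  by (subst AE_distr_iff) (auto simp: space_sphere_measure measurable_sphere_measure)

lemma integral_sphere_measure:
  fixes f :: "real^3 \<Rightarrow> 'b::{banach, second_countable_topology}"
  assumes "\<And>n. norm n = 1 \<Longrightarrow> f n = f' n" and [measurable]: "f' \<in> borel_measurable borel"
  shows "(LINT n|sphere_measure. f n) = (LINT n|sphere_borel. f' n)"
proof -
  have "(LINT n|sphere_measure. f n) = (LINT n|sphere_measure. f' n)"
    by (intro Bochner_Integration.integral_cong) (auto simp: space_sphere_measure assms(1))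
  then show ?thesis unfolding sphere_borel_def by (simp add: integral_distr measurable_sphere_measure)
qed

lemma nn_integral_sphere_measure:
  assumes "\<And>n. norm n = 1 \<Longrightarrow> f n = f' n" and [measurable]: "f' \<in> borel_measurable borel"
  shows "(\<integral>\<^sup>+n. f n \<partial>sphere_measure) = (\<integral>\<^sup>+n. f' n \<partial>sphere_borel)"
proof -
  have "(\<integral>\<^sup>+n. f n \<partial>sphere_measure) = (\<integral>\<^sup>+n. f' n \<partial>sphere_measure)"
    by (intro nn_integral_cong) (auto simp: space_sphere_measure assms(1))
  then show ?thesis unfolding sphere_borel_def by (simp add: nn_integral_distr measurable_sphere_measure)
qed

text \<open>
  A common bound and a common support for a test function and its derivatives in all directions; the
  bound on the derivative is uniform in the direction because it is linear in it.
\<close>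

lemma test_function_props:
  assumes "test_function \<Omega> \<phi>"
  defines "D \<equiv> \<lambda>x. frechet_derivative \<phi> (at x)"
  obtains C K where "compact K" "K \<subseteq> \<Omega>"
    "\<And>x. (\<phi> has_derivative D x) (at x)" "\<And>v. continuous_on UNIV (\<lambda>x. D x v)"
    "\<And>x. \<bar>\<phi> x\<bar> \<le> C * indicator K x" "\<And>x n. norm n = 1 \<Longrightarrow> \<bar>D x n\<bar> \<le> C * indicator K x"
    "\<And>x v. x \<notin> K \<Longrightarrow> D x v = 0"
proof -
  define K where "K = closure {x. \<phi> x \<noteq> 0}"
  have K: "compact K" "K \<subseteq> \<Omega>" using assms(1) by (auto simp: test_function_def K_def)
  have "Ck (Suc 0) \<phi>" using assms(1) unfolding test_function_def by blast
  then have D: "\<And>x. (\<phi> has_derivative D x) (at x)" and cont: "\<And>v. continuous_on UNIV (\<lambda>x. D x v)"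
    by (auto simp: D_def frechet_derivative_works)
  have out: "\<phi> x = 0" if "x \<notin> K" for x
    using that closure_subset[of "{x. \<phi> x \<noteq> 0}"] unfolding K_def by blast
  have Dout: "D x v = 0" if "x \<notin> K" for x v
  proof -
    have "(\<phi> has_derivative (\<lambda>_. 0)) (at x)"
      by (rule has_derivative_transform_within_open[of "\<lambda>_. 0" _ _ _ "- K"])
         (use that K in \<open>auto simp: out compact_imp_closed\<close>)
    then have "D x = (\<lambda>_. 0)" using D has_derivative_unique by blast
    then show ?thesis by simp
  qed
  have bounded: "\<exists>C. \<forall>x. \<bar>f x\<bar> \<le> C"
    if c: "continuous_on UNIV f" and z: "\<And>x. x \<notin> K \<Longrightarrow> f x = 0" for f :: "real^3 \<Rightarrow> real"
  proof -
    have "bounded (f ` K)"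
      by (intro compact_imp_bounded compact_continuous_image continuous_on_subset[OF c] K) auto
    then obtain C where "\<forall>x\<in>K. \<bar>f x\<bar> \<le> C" by (auto simp: bounded_iff)
    then have "\<forall>x. \<bar>f x\<bar> \<le> max C 0"
      using z by (metis abs_zero max.cobounded2 max.coboundedI1)
    then show ?thesis by blast
  qed
  have c\<phi>: "continuous_on UNIV \<phi>"
    by (intro continuous_at_imp_continuous_on ballI has_derivative_continuous[OF D])
  obtain C0 where C0: "\<And>x. \<bar>\<phi> x\<bar> \<le> C0" using bounded[OF c\<phi> out] by blast
  have "\<forall>b. \<exists>C. \<forall>x. \<bar>D x b\<bar> \<le> C" using bounded[OF cont Dout] by blast
  then obtain B where B: "\<And>b x. \<bar>D x b\<bar> \<le> B b" by metis
  define C where "C = max C0 (\<Sum>b\<in>Basis. B b)"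
  have DC: "\<bar>D x n\<bar> \<le> C" if "norm n = 1" for x n
  proof -
    have "D x n = D x (\<Sum>b\<in>Basis. (n \<bullet> b) *\<^sub>R b)" by (simp add: euclidean_representation)
    also have "\<dots> = (\<Sum>b\<in>Basis. (n \<bullet> b) * D x b)"
      using has_derivative_linear[OF D] by (simp add: linear_sum linear_cmul)
    also have "\<bar>\<dots>\<bar> \<le> (\<Sum>b\<in>Basis. B b)"
    proof (rule order_trans[OF sum_abs sum_mono])
      fix b :: "real^3" assume "b \<in> Basis"
      then have "\<bar>n \<bullet> b\<bar> \<le> 1" using Basis_le_norm[of b n] that by simp
      then have "\<bar>n \<bullet> b\<bar> * \<bar>D x b\<bar> \<le> 1 * B b"
        by (intro mult_mono B) auto
      then show "\<bar>(n \<bullet> b) * D x b\<bar> \<le> B b" by (simp add: abs_mult)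
    qed
    finally show ?thesis by (simp add: C_def)
  qed
  show ?thesis
  proof (rule that[OF K D cont])
    show "\<bar>\<phi> x\<bar> \<le> C * indicator K x" for x
      using C0[of x] out[of x] by (auto simp: C_def indicator_def)
    show "\<bar>D x n\<bar> \<le> C * indicator K x" if "norm n = 1" for x n
      using DC[OF that] Dout by (auto simp: indicator_def)
  qed (use Dout in auto)
qed

lemma measurable_test_function_derivative:
  assumes \<phi>: "test_function \<Omega> \<phi>"
    and [measurable]: "f \<in> borel_measurable M" "d \<in> borel_measurable M"
  shows "(\<lambda>p. frechet_derivative \<phi> (at (f p)) (d p)) \<in> borel_measurable M"
proof -
  let ?D = "\<lambda>x. frechet_derivative \<phi> (at x)"
  have "Ck (Suc 0) \<phi>" using \<phi> unfolding test_function_def by blast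
  then have D: "\<And>x. (\<phi> has_derivative ?D x) (at x)" and cont: "\<And>v. continuous_on UNIV (\<lambda>x. ?D x v)"
    by (auto simp: frechet_derivative_works)
  have [measurable]: "(\<lambda>x. ?D x v) \<in> borel_measurable borel" for v
    using cont by (rule borel_measurable_continuous_onI)
  have lin: "?D x v = (\<Sum>b\<in>Basis. (v \<bullet> b) * ?D x b)" for x v
  proof -
    have "?D x v = ?D x (\<Sum>b\<in>Basis. (v \<bullet> b) *\<^sub>R b)" by (simp add: euclidean_representation)
    then show ?thesis
      using has_derivative_linear[OF D] by (simp add: linear_sum linear_cmul)
  qed
  show ?thesis by (subst lin) measurable
qed

lemma nn_integral_nn_ray_avg_sphere:
  fixes f :: "real^3 \<Rightarrow> ennreal"
  assumes [measurable]: "f \<in> borel_measurable borel"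
  shows "(\<integral>\<^sup>+x. \<integral>\<^sup>+n. nn_ray_avg f x n \<partial>sphere_borel \<partial>lborel) =
     emeasure sphere_borel UNIV * (\<integral>\<^sup>+z. f z \<partial>lborel)"
  by (subst lborel_sphere.Fubini'[symmetric]) (auto simp: nn_integral_nn_ray_avg mult.commute)

text \<open>
  If the integral along the ray does not exist, the left-hand side is 0 by convention.
\<close>

lemma ennreal_ray_avg_le:
  assumes [measurable]: "w \<in> borel_measurable borel"
  shows "ennreal \<bar>ray_avg w x n\<bar> \<le> nn_ray_avg (\<lambda>z. ennreal \<bar>w z\<bar>) x n"
proof (cases "integrable path_length_law (\<lambda>t. w (x - t *\<^sub>R n))")
  case True
  then show ?thesis
    using integral_norm_bound_ennreal[OF True] by (simp add: ray_avg_def nn_ray_avg_def)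
qed (simp add: ray_avg_def not_integrable_integral_eq)

section \<open>The weak divergence of the frequency-integrated flux\<close>

text \<open>
  The frequency-integrated problem: \<open>G\<close> stands for the incoming radiation summed over frequencies and \<open>u\<close>
  below for the emission \<open>\<sigma> T\<^sup>4\<close>.
\<close>

locale radiative_body =
  fixes \<Omega> :: "(real^3) set" and G :: "real^3 \<Rightarrow> real"
  assumes open_body: "open \<Omega>" and convex_body: "convex \<Omega>" and bounded_body: "bounded \<Omega>"
    and measurable_G [measurable]: "G \<in> borel_measurable borel"
    and G_nonneg: "\<And>n. 0 \<le> G n"
    and integrable_G: "integrable sphere_borel G"
begin

lemma sets_body [measurable]: "\<Omega> \<in> sets borel"
  using open_body by auto

text \<open>
  For \<open>x\<close> in \<open>\<Omega>\<close> this is \<open>exp(-s(x, n))\<close>, the fraction of the incoming radiation that reaches \<open>x\<close>.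
\<close>

definition transmission :: "real^3 \<Rightarrow> real^3 \<Rightarrow> real" where
  "transmission x n = 1 - ray_avg (indicat_real \<Omega>) x n"

lemma measurable_transmission [measurable (raw)]:
  assumes [measurable]: "f \<in> borel_measurable M" "d \<in> borel_measurable M"
  shows "(\<lambda>p. transmission (f p) (d p)) \<in> borel_measurable M"
  unfolding transmission_def by measurable

lemma transmission_bounds: "0 \<le> transmission x n" "transmission x n \<le> 1"
proof -
  have "ray_avg (indicat_real \<Omega>) x n \<le> 1"
    unfolding ray_avg_def
    by (intro path_length.integral_le_const path_length.integrable_const_bound[where B = 1]) auto
  moreover have "0 \<le> ray_avg (indicat_real \<Omega>) x n"
    unfolding ray_avg_def by (intro integral_nonneg_AE) auto
  ultimately show "0 \<le> transmission x n" "transmission x n \<le> 1"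
    by (auto simp: transmission_def)
qed

definition total_intensity :: "(real^3 \<Rightarrow> real) \<Rightarrow> real^3 \<Rightarrow> real^3 \<Rightarrow> real" where
  "total_intensity u x n = G n * transmission x n + ray_avg u x n"

lemma measurable_total_intensity [measurable (raw)]:
  assumes [measurable]: "u \<in> borel_measurable borel" "f \<in> borel_measurable M" "d \<in> borel_measurable M"
  shows "(\<lambda>p. total_intensity u (f p) (d p)) \<in> borel_measurable M"
  unfolding total_intensity_def by measurable

definition total_flux :: "(real^3 \<Rightarrow> real) \<Rightarrow> real^3 \<Rightarrow> real^3" where
  "total_flux u x = (LINT n|sphere_borel. total_intensity u x n *\<^sub>R n)"

lemma measurable_total_flux [measurable]:
  assumes [measurable]: "u \<in> borel_measurable borel"
  shows "total_flux u \<in> borel_measurable borel"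
  unfolding total_flux_def by measurable

text \<open>
  One integrability statement for all later applications of Fubini's theorem. The factor \<open>\<psi>\<close> is an
  indicator, a direction vector, a test function or its derivative; each is bounded and supported in a
  bounded set.
\<close>

lemma integrable_total_intensity:
  fixes \<psi> :: "real^3 \<Rightarrow> real^3 \<Rightarrow> 'b::{banach, second_countable_topology}"
  assumes u: "integrable lborel u"
    and [measurable]: "(\<lambda>(x, n). \<psi> x n) \<in> borel_measurable (borel \<Otimes>\<^sub>M borel)" "K \<in> sets borel"
    and K: "bounded K"
    and bound: "\<And>x n. norm n = 1 \<Longrightarrow> norm (\<psi> x n) \<le> C * indicator K x"
  shows "integrable (lborel \<Otimes>\<^sub>M sphere_borel) (\<lambda>(x, n). total_intensity u x n *\<^sub>R \<psi> x n)"
proof (rule integrableI_bounded)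
  have [measurable]: "u \<in> borel_measurable borel" using u by auto
  show meas: "(\<lambda>(x, n). total_intensity u x n *\<^sub>R \<psi> x n) \<in> borel_measurable (lborel \<Otimes>\<^sub>M sphere_borel)"
    by measurable
  have AE: "AE n in sphere_borel. \<forall>x. ennreal (norm (total_intensity u x n *\<^sub>R \<psi> x n)) \<le>
      ennreal \<bar>C\<bar> * (ennreal (G n) * indicator K x + nn_ray_avg (\<lambda>z. ennreal \<bar>u z\<bar>) x n)"
    using AE_sphere_borel_norm
  proof eventually_elim
    case (elim n)
    show ?case
    proof
      fix x
      have "norm (total_intensity u x n *\<^sub>R \<psi> x n) \<le> (G n + \<bar>ray_avg u x n\<bar>) * (\<bar>C\<bar> * indicator K x)"
        unfolding norm_scaleR
      proof (rule mult_mono)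
        have "\<bar>G n * transmission x n\<bar> \<le> G n * 1"
          using transmission_bounds[of x n] G_nonneg[of n] unfolding abs_mult by (intro mult_mono) auto
        then show "\<bar>total_intensity u x n\<bar> \<le> G n + \<bar>ray_avg u x n\<bar>"
          unfolding total_intensity_def by linarith
        show "norm (\<psi> x n) \<le> \<bar>C\<bar> * indicator K x"
          using bound[OF elim, of x] by (auto simp: indicator_def)
      qed (use G_nonneg in auto)
      also have "\<dots> \<le> \<bar>C\<bar> * (G n * indicator K x + \<bar>ray_avg u x n\<bar>)"
        by (auto simp: indicator_def algebra_simps)
      finally have "ennreal (norm (total_intensity u x n *\<^sub>R \<psi> x n)) \<le>
          ennreal (\<bar>C\<bar> * (G n * indicator K x + \<bar>ray_avg u x n\<bar>))"
        by (rule ennreal_leI)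
      also have "\<dots> = ennreal \<bar>C\<bar> * (ennreal (G n) * indicator K x + ennreal \<bar>ray_avg u x n\<bar>)"
        using G_nonneg by (auto simp: ennreal_mult' indicator_def)
      also have "\<dots> \<le> ennreal \<bar>C\<bar> * (ennreal (G n) * indicator K x + nn_ray_avg (\<lambda>z. ennreal \<bar>u z\<bar>) x n)"
        by (intro mult_left_mono add_left_mono ennreal_ray_avg_le) auto
      finally show "ennreal (norm (total_intensity u x n *\<^sub>R \<psi> x n)) \<le>
          ennreal \<bar>C\<bar> * (ennreal (G n) * indicator K x + nn_ray_avg (\<lambda>z. ennreal \<bar>u z\<bar>) x n)" .
    qed
  qed
  have "(\<integral>\<^sup>+p. ennreal (norm (case p of (x, n) \<Rightarrow> total_intensity u x n *\<^sub>R \<psi> x n)) \<partial>(lborel \<Otimes>\<^sub>M sphere_borel))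
      = (\<integral>\<^sup>+x. \<integral>\<^sup>+n. ennreal (norm (total_intensity u x n *\<^sub>R \<psi> x n)) \<partial>sphere_borel \<partial>lborel)"
    by (subst sphere_borel.nn_integral_fst[symmetric]) auto
  also have "\<dots> \<le> (\<integral>\<^sup>+x. \<integral>\<^sup>+n. ennreal \<bar>C\<bar> * (ennreal (G n) * indicator K x +
        nn_ray_avg (\<lambda>z. ennreal \<bar>u z\<bar>) x n) \<partial>sphere_borel \<partial>lborel)"
    by (intro nn_integral_mono nn_integral_mono_AE) (use AE in \<open>auto elim: eventually_mono\<close>)
  also have "\<dots> = ennreal \<bar>C\<bar> * ((\<integral>\<^sup>+n. ennreal (G n) \<partial>sphere_borel) * emeasure lborel K +
        emeasure sphere_borel UNIV * (\<integral>\<^sup>+z. ennreal \<bar>u z\<bar> \<partial>lborel))"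
  proof -
    have "(\<integral>\<^sup>+n. ennreal \<bar>C\<bar> * (ennreal (G n) * indicator K x + nn_ray_avg (\<lambda>z. ennreal \<bar>u z\<bar>) x n) \<partial>sphere_borel) =
       ennreal \<bar>C\<bar> * ((\<integral>\<^sup>+n. ennreal (G n) \<partial>sphere_borel) * indicator K x +
         (\<integral>\<^sup>+n. nn_ray_avg (\<lambda>z. ennreal \<bar>u z\<bar>) x n \<partial>sphere_borel))" for x
      by (subst nn_integral_cmult, measurable, subst nn_integral_add, measurable, subst nn_integral_multc)
         measurable
    then show ?thesis
      by (subst nn_integral_nn_ray_avg_sphere[symmetric], measurable)
         (simp add: nn_integral_cmult nn_integral_add)
  qed
  also have "\<dots> < \<infinity>"
    using u integrable_G K emeasure_sphere_borel_bounds(1) emeasure_bounded_finite[OF K] G_nonneg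
    by (auto simp: integrable_iff_bounded ennreal_mult_less_top)
  finally show "(\<integral>\<^sup>+p. ennreal (norm (case p of (x, n) \<Rightarrow> total_intensity u x n *\<^sub>R \<psi> x n))
      \<partial>(lborel \<Otimes>\<^sub>M sphere_borel)) < \<infinity>" .
qed

text \<open>
  The integral over all directions, without division by the area of the sphere.
\<close>

definition mean_intensity :: "(real^3 \<Rightarrow> real) \<Rightarrow> real^3 \<Rightarrow> real" where
  "mean_intensity u x = (LINT n|sphere_borel. total_intensity u x n)"

lemma measurable_mean_intensity [measurable]:
  assumes [measurable]: "u \<in> borel_measurable borel"
  shows "mean_intensity u \<in> borel_measurable borel"
  unfolding mean_intensity_def by measurable

lemma set_integrable_mean_intensity:
  assumes u: "integrable lborel u"
  shows "set_integrable lborel \<Omega> (mean_intensity u)"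
proof -
  have "integrable (lborel \<Otimes>\<^sub>M sphere_borel) (\<lambda>(x, n). total_intensity u x n *\<^sub>R indicat_real \<Omega> x)"
    by (rule integrable_total_intensity[OF u _ sets_body bounded_body, where C = 1]) auto
  from lborel_sphere.integrable_fst'[OF this] show ?thesis
    by (simp add: set_integrable_def mean_intensity_def mult.commute)
qed

lemma set_integrable_total_flux:
  assumes u: "integrable lborel u"
  shows "set_integrable lborel \<Omega> (total_flux u)"
    and "AE x in lborel. x \<in> \<Omega> \<longrightarrow> integrable sphere_borel (\<lambda>n. total_intensity u x n *\<^sub>R n)"
proof -
  have I: "integrable (lborel \<Otimes>\<^sub>M sphere_borel) (\<lambda>(x, n). total_intensity u x n *\<^sub>R (indicat_real \<Omega> x *\<^sub>R n))"
    by (rule integrable_total_intensity[OF u _ sets_body bounded_body, where C = 1]) auto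
  have "(LINT n|sphere_borel. total_intensity u x n *\<^sub>R (indicat_real \<Omega> x *\<^sub>R n)) = indicat_real \<Omega> x *\<^sub>R total_flux u x" for x
    by (cases "x \<in> \<Omega>") (auto simp: total_flux_def)
  with lborel_sphere.integrable_fst'[OF I] show "set_integrable lborel \<Omega> (total_flux u)"
    by (simp add: set_integrable_def)
  have "AE x in lborel. integrable sphere_borel (\<lambda>n. total_intensity u x n *\<^sub>R (indicat_real \<Omega> x *\<^sub>R n))"
    using lborel_sphere.AE_integrable_fst'[OF I] by simp
  then show "AE x in lborel. x \<in> \<Omega> \<longrightarrow> integrable sphere_borel (\<lambda>n. total_intensity u x n *\<^sub>R n)"
    by eventually_elim auto
qed

text \<open>
  The intensity is \<open>G n - G n * ray_avg (indicator \<Omega>) + ray_avg u\<close>. The first term contributes the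
  integral of a derivative, which vanishes, and the other two are instances of the transport equation.
\<close>

lemma directional_weak_form:
  assumes D: "\<And>x. (\<phi> has_derivative D x) (at x)" and cont: "continuous_on UNIV (\<lambda>x. D x n)"
    and K: "compact K" "K \<subseteq> \<Omega>"
    and b\<phi>: "\<And>x. \<bar>\<phi> x\<bar> \<le> C * indicator K x" and bD: "\<And>x. \<bar>D x n\<bar> \<le> C * indicator K x"
    and u: "integrable lborel u"
  shows "(LINT x|lborel. total_intensity u x n * D x n) =
         (LINT x|lborel. total_intensity u x n * \<phi> x) - (LINT x|lborel. u x * \<phi> x)"
proof -
  have c\<phi>: "continuous_on UNIV \<phi>"
    by (intro continuous_at_imp_continuous_on ballI has_derivative_continuous[OF D])
  have [measurable]: "\<phi> \<in> borel_measurable borel" "(\<lambda>x. D x n) \<in> borel_measurable borel" "K \<in> sets borel"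
    using c\<phi> cont K by (auto intro: borel_measurable_continuous_onI simp: compact_imp_closed)
  have b\<phi>': "\<bar>\<phi> x\<bar> \<le> \<bar>C\<bar>" and bD': "\<bar>D x n\<bar> \<le> \<bar>C\<bar>" for x
    using b\<phi>[of x] bD[of x] by (cases "x \<in> K"; simp)+
  have i1: "integrable lborel (indicat_real \<Omega>)"
    using emeasure_bounded_finite[OF bounded_body] by simp
  have iK: "integrable lborel (\<lambda>x. C * indicat_real K x)"
    using emeasure_bounded_finite[OF compact_imp_bounded[OF K(1)]] by simp
  have i\<phi>: "integrable lborel \<phi>"
    by (rule Bochner_Integration.integrable_bound[OF iK]) (auto intro!: AE_I2 order_trans[OF b\<phi>])
  have iD: "integrable lborel (\<lambda>x. D x n)"
    by (rule Bochner_Integration.integrable_bound[OF iK]) (auto intro!: AE_I2 order_trans[OF bD])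
  have split: "(LINT x|lborel. total_intensity u x n * f x) =
      G n * (LINT x|lborel. f x) - G n * (LINT x|lborel. ray_avg (indicat_real \<Omega>) x n * f x)
      + (LINT x|lborel. ray_avg u x n * f x)"
    if f: "integrable lborel f" and b: "\<And>x. \<bar>f x\<bar> \<le> \<bar>C\<bar>" for f
  proof -
    have m: "f \<in> borel_measurable borel" using f by auto
    have "(LINT x|lborel. total_intensity u x n * f x) =
       (LINT x|lborel. G n * f x - G n * (ray_avg (indicat_real \<Omega>) x n * f x) + ray_avg u x n * f x)"
      by (intro Bochner_Integration.integral_cong)
         (auto simp: total_intensity_def transmission_def algebra_simps)
    then show ?thesis
      using f ray_avg_adjoint(1)[OF i1 m b, of n] ray_avg_adjoint(1)[OF u m b, of n] by simp
  qed
  have \<Omega>\<phi>: "indicat_real \<Omega> x * \<phi> x = \<phi> x" for x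
    using b\<phi>[of x] K(2) by (cases "x \<in> K") auto
  have i\<Omega>\<phi>: "(LINT x|lborel. indicat_real \<Omega> x * \<phi> x) = (LINT x|lborel. \<phi> x)"
    by (simp add: \<Omega>\<phi>)
  show ?thesis
    unfolding split[OF iD bD'] split[OF i\<phi> b\<phi>'] integral_directional_derivative_zero[OF D cont b\<phi>' bD' i\<phi> iD]
      transport_weak_form[OF D cont b\<phi>' bD' u] transport_weak_form[OF D cont b\<phi>' bD' i1] i\<Omega>\<phi>
    by (simp add: algebra_simps)
qed

text \<open>
  Integrate the identity for a fixed direction over the sphere. The test function is supported in
  \<open>\<Omega>\<close>, so both sides see the intensity only where it has its physical meaning.
\<close>

lemma total_flux_weak_divergence:
  assumes \<phi>: "test_function \<Omega> \<phi>" and u: "integrable lborel u"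
  shows "(LINT x:\<Omega>|lborel. frechet_derivative \<phi> (at x) (total_flux u x)) =
         (LINT x|lborel. \<phi> x * (indicator \<Omega> x * (mean_intensity u x - measure sphere_borel UNIV * u x)))"
proof -
  let ?D = "\<lambda>x. frechet_derivative \<phi> (at x)"
  obtain C K where K: "compact K" "K \<subseteq> \<Omega>"
    and D: "\<And>x. (\<phi> has_derivative ?D x) (at x)" and cont: "\<And>v. continuous_on UNIV (\<lambda>x. ?D x v)"
    and b\<phi>: "\<And>x. \<bar>\<phi> x\<bar> \<le> C * indicator K x" and bD: "\<And>x n. norm n = 1 \<Longrightarrow> \<bar>?D x n\<bar> \<le> C * indicator K x"
    and Dout: "\<And>x v. x \<notin> K \<Longrightarrow> ?D x v = 0"
    using test_function_props[OF \<phi>] by metis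
  have [measurable]: "u \<in> borel_measurable borel" using u by auto
  have [measurable]: "K \<in> sets borel" using K by (auto simp: compact_imp_closed)
  have c\<phi>: "continuous_on UNIV \<phi>"
    by (intro continuous_at_imp_continuous_on ballI has_derivative_continuous[OF D])
  have [measurable]: "\<phi> \<in> borel_measurable borel"
    using c\<phi> by (rule borel_measurable_continuous_onI)
  note [measurable (raw)] = measurable_test_function_derivative[OF \<phi>]
  have m1: "(\<lambda>(x, n). ?D x n) \<in> borel_measurable (borel \<Otimes>\<^sub>M borel)"
    and m2: "(\<lambda>(x, n :: real^3). \<phi> x) \<in> borel_measurable (borel \<Otimes>\<^sub>M borel)"
    by measurable
  have ID: "integrable (lborel \<Otimes>\<^sub>M sphere_borel) (\<lambda>(x, n). total_intensity u x n *\<^sub>R ?D x n)"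
    by (rule integrable_total_intensity[OF u m1, where C = C and K = K])
       (use bD K in \<open>auto simp: compact_imp_bounded\<close>)
  have I\<phi>: "integrable (lborel \<Otimes>\<^sub>M sphere_borel) (\<lambda>(x, n). total_intensity u x n *\<^sub>R \<phi> x)"
    by (rule integrable_total_intensity[OF u m2, where C = C and K = K])
       (use b\<phi> K in \<open>auto simp: compact_imp_bounded\<close>)
  have i\<phi>u: "integrable lborel (\<lambda>x. u x * \<phi> x)"
  proof (rule Bochner_Integration.integrable_bound)
    show "integrable lborel (\<lambda>x. \<bar>C\<bar> * u x)" using u by simp
    have "\<bar>\<phi> x\<bar> \<le> \<bar>C\<bar>" for x
      using b\<phi>[of x] by (cases "x \<in> K"; simp)
    then show "AE x in lborel. norm (u x * \<phi> x) \<le> norm (\<bar>C\<bar> * u x)"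
      by (auto simp: abs_mult mult.commute intro!: mult_right_mono)
  qed measurable
  have "(LINT x:\<Omega>|lborel. ?D x (total_flux u x)) =
        (LINT x|lborel. LINT n|sphere_borel. total_intensity u x n * ?D x n)"
    unfolding set_lebesgue_integral_def
  proof (rule integral_cong_AE)
    show "AE x in lborel. indicat_real \<Omega> x *\<^sub>R ?D x (total_flux u x) =
        (LINT n|sphere_borel. total_intensity u x n * ?D x n)"
      using set_integrable_total_flux(2)[OF u]
    proof eventually_elim
      case (elim x)
      show ?case
      proof (cases "x \<in> \<Omega>")
        case True
        have "bounded_linear (?D x)" using D by (rule has_derivative_bounded_linear)
        from integral_bounded_linear[OF this, of sphere_borel "\<lambda>n. total_intensity u x n *\<^sub>R n"]
        show ?thesis
          using True elim has_derivative_linear[OF D, of x]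
          by (simp add: total_flux_def linear_cmul)
      next
        case False
        then have "x \<notin> K" using K(2) by blast
        with False show ?thesis by (simp add: Dout)
      qed
    qed
  qed measurable
  also have "\<dots> = (LINT n|sphere_borel. LINT x|lborel. total_intensity u x n * ?D x n)"
    using lborel_sphere.Fubini_integral[OF ID] by simp
  also have "\<dots> = (LINT n|sphere_borel. (LINT x|lborel. total_intensity u x n * \<phi> x) - (LINT x|lborel. u x * \<phi> x))"
  proof (rule integral_cong_AE)
    show "AE n in sphere_borel. (LINT x|lborel. total_intensity u x n * ?D x n) =
        (LINT x|lborel. total_intensity u x n * \<phi> x) - (LINT x|lborel. u x * \<phi> x)"
      using AE_sphere_borel_norm
      by eventually_elim (rule directional_weak_form[OF D cont K b\<phi> bD u])
  qed measurable
  also have "\<dots> = (LINT n|sphere_borel. LINT x|lborel. total_intensity u x n * \<phi> x)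
      - measure sphere_borel UNIV * (LINT x|lborel. u x * \<phi> x)"
    using lborel_sphere.integrable_snd[of "\<lambda>x n. total_intensity u x n * \<phi> x"] I\<phi> by simp
  also have "(LINT n|sphere_borel. LINT x|lborel. total_intensity u x n * \<phi> x) =
     (LINT x|lborel. LINT n|sphere_borel. total_intensity u x n * \<phi> x)"
    using lborel_sphere.Fubini_integral[OF I\<phi>] by simp
  also have "(LINT x|lborel. LINT n|sphere_borel. total_intensity u x n * \<phi> x) =
     (LINT x|lborel. mean_intensity u x * \<phi> x)"
    by (simp add: mean_intensity_def)
  also have "\<dots> - measure sphere_borel UNIV * (LINT x|lborel. u x * \<phi> x) =
     (LINT x|lborel. mean_intensity u x * \<phi> x - measure sphere_borel UNIV * (u x * \<phi> x))"
    using i\<phi>u lborel_sphere.integrable_fst'[OF I\<phi>] by (simp add: mean_intensity_def)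
  also have "\<dots> = (LINT x|lborel. \<phi> x * (indicator \<Omega> x * (mean_intensity u x - measure sphere_borel UNIV * u x)))"
  proof (intro Bochner_Integration.integral_cong refl)
    fix x
    have "\<phi> x = indicat_real \<Omega> x * \<phi> x"
      using b\<phi>[of x] K(2) by (cases "x \<in> K") auto
    then show "mean_intensity u x * \<phi> x - measure sphere_borel UNIV * (u x * \<phi> x) =
       \<phi> x * (indicator \<Omega> x * (mean_intensity u x - measure sphere_borel UNIV * u x))"
      by (auto simp: indicator_def algebra_simps)
  qed
  finally show ?thesis .
qed

lemma total_flux_divergence_free_iff:
  assumes u: "integrable lborel u"
  shows "divergence_free_on \<Omega> (total_flux u) \<longleftrightarrow>
    (AE x in lborel. x \<in> \<Omega> \<longrightarrow> measure sphere_borel UNIV * u x = mean_intensity u x)"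
proof
  let ?r = "\<lambda>x. indicat_real \<Omega> x * (mean_intensity u x - measure sphere_borel UNIV * u x)"
  assume div: "divergence_free_on \<Omega> (total_flux u)"
  have "AE x in lborel. x \<in> \<Omega> \<longrightarrow> ?r x = 0"
  proof (rule AE_zero_if_orthogonal_to_test_functions[OF open_body])
    have "integrable lborel (\<lambda>x. indicat_real \<Omega> x *\<^sub>R mean_intensity u x - measure sphere_borel UNIV *\<^sub>R (indicat_real \<Omega> x *\<^sub>R u x))"
      using set_integrable_mean_intensity[OF u] integrable_mult_indicator[OF _ u, of \<Omega>]
      by (intro Bochner_Integration.integrable_diff integrable_scaleR_right) (auto simp: set_integrable_def)
    then show "integrable lborel ?r" by (simp add: algebra_simps)
    show "(LINT x|lborel. \<phi> x * ?r x) = 0" if "test_function \<Omega> \<phi>" for \<phi>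
      using div that total_flux_weak_divergence[OF that u] by (simp add: divergence_free_on_def)
  qed
  then show "AE x in lborel. x \<in> \<Omega> \<longrightarrow> measure sphere_borel UNIV * u x = mean_intensity u x"
    by eventually_elim auto
next
  have [measurable]: "u \<in> borel_measurable borel" using u by auto
  assume eq: "AE x in lborel. x \<in> \<Omega> \<longrightarrow> measure sphere_borel UNIV * u x = mean_intensity u x"
  show "divergence_free_on \<Omega> (total_flux u)"
    unfolding divergence_free_on_def
  proof (intro conjI allI impI)
    fix K assume "compact K \<and> K \<subseteq> \<Omega>"
    then show "set_integrable lborel K (total_flux u)"
      by (intro set_integrable_subset[OF set_integrable_total_flux(1)[OF u]]) (auto simp: compact_imp_closed)
  next
    fix \<phi> assume \<phi>: "test_function \<Omega> \<phi>"
    have "continuous_on UNIV \<phi>"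
      using \<phi> unfolding test_function_def by (metis Ck.simps(1))
    then have [measurable]: "\<phi> \<in> borel_measurable borel" by (rule borel_measurable_continuous_onI)
    have "(LINT x|lborel. \<phi> x * (indicator \<Omega> x * (mean_intensity u x - measure sphere_borel UNIV * u x))) =
       (LINT x|(lborel :: (real^3) measure). 0)"
      by (rule integral_cong_AE) (use eq in \<open>auto elim!: eventually_mono\<close>)
    then show "(LINT x:\<Omega>|lborel. frechet_derivative \<phi> (at x) (total_flux u x)) = 0"
      by (simp add: total_flux_weak_divergence[OF \<phi> u])
  qed
qed

end

section \<open>Radiative equilibrium as a contraction\<close>

text \<open>
  By the adjoint formula, the average over \<open>x\<close>, \<open>n\<close> and \<open>t\<close> of the indicator of a null set at \<open>x - t n\<close> is a
  multiple of the measure of that set.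
\<close>

lemma AE_along_rays:
  assumes "AE z in lborel. P z"
  shows "AE x in lborel. AE n in sphere_borel. AE t in path_length_law. P (x - t *\<^sub>R n)"
proof -
  obtain N where N: "{z. \<not> P z} \<subseteq> N" "emeasure lborel N = 0" "N \<in> sets lborel"
    using AE_E[OF assms] by auto
  then have [measurable]: "N \<in> sets borel" by simp
  have "(\<integral>\<^sup>+x. \<integral>\<^sup>+n. nn_ray_avg (indicator N) x n \<partial>sphere_borel \<partial>lborel) =
      emeasure sphere_borel UNIV * emeasure lborel N"
    by (subst nn_integral_nn_ray_avg_sphere) auto
  then have "AE x in lborel. (\<integral>\<^sup>+n. nn_ray_avg (indicator N) x n \<partial>sphere_borel) = 0"
    by (subst (asm) N(2), subst (asm) mult_zero_right, subst (asm) nn_integral_0_iff_AE) measurable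
  then show ?thesis
  proof eventually_elim
    case (elim x)
    then have "AE n in sphere_borel. nn_ray_avg (indicator N) x n = 0"
      by (subst (asm) nn_integral_0_iff_AE) measurable
    then show ?case
    proof eventually_elim
      case (elim n)
      then have "AE t in path_length_law. (indicator N (x - t *\<^sub>R n) :: ennreal) = 0"
        unfolding nn_ray_avg_def by (subst (asm) nn_integral_0_iff_AE) measurable
      then show ?case
        by eventually_elim (use N(1) in \<open>auto simp: indicator_def split: if_splits\<close>)
    qed
  qed
qed

lemma measurable_nn_ray_avg_direction [measurable]:
  assumes [measurable]: "w \<in> borel_measurable borel"
  shows "nn_ray_avg w x \<in> borel_measurable borel"
  unfolding nn_ray_avg_def[abs_def] by measurable

lemma AE_integrable_along_rays:
  assumes u: "integrable lborel u"
  shows "AE x in lborel. (\<integral>\<^sup>+n. nn_ray_avg (\<lambda>z. ennreal \<bar>u z\<bar>) x n \<partial>sphere_borel) < \<infinity>"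
    and "AE x in lborel. AE n in sphere_borel. integrable path_length_law (\<lambda>t. u (x - t *\<^sub>R n))"
proof -
  have [measurable]: "u \<in> borel_measurable borel" using u by auto
  have "(\<integral>\<^sup>+x. \<integral>\<^sup>+n. nn_ray_avg (\<lambda>z. ennreal \<bar>u z\<bar>) x n \<partial>sphere_borel \<partial>lborel) =
      emeasure sphere_borel UNIV * (\<integral>\<^sup>+z. ennreal \<bar>u z\<bar> \<partial>lborel)"
    by (rule nn_integral_nn_ray_avg_sphere) measurable
  also have "\<dots> \<noteq> \<infinity>"
    using u emeasure_sphere_borel_bounds(1) by (auto simp: integrable_iff_bounded ennreal_mult_eq_top_iff)
  finally have "AE x in lborel. (\<integral>\<^sup>+n. nn_ray_avg (\<lambda>z. ennreal \<bar>u z\<bar>) x n \<partial>sphere_borel) \<noteq> \<infinity>"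
    by (intro nn_integral_PInf_AE) measurable
  then show 1: "AE x in lborel. (\<integral>\<^sup>+n. nn_ray_avg (\<lambda>z. ennreal \<bar>u z\<bar>) x n \<partial>sphere_borel) < \<infinity>"
    by eventually_elim (auto simp: less_top)
  then show "AE x in lborel. AE n in sphere_borel. integrable path_length_law (\<lambda>t. u (x - t *\<^sub>R n))"
  proof eventually_elim
    case (elim x)
    then have "AE n in sphere_borel. nn_ray_avg (\<lambda>z. ennreal \<bar>u z\<bar>) x n \<noteq> \<infinity>"
      by (intro nn_integral_PInf_AE) auto
    then show ?case
      by eventually_elim (auto simp: nn_ray_avg_def integrable_iff_bounded less_top)
  qed
qed

context radiative_body
begin

lemma AE_integrable_total_intensity:
  assumes u: "integrable lborel u"
  shows "AE x in lborel. x \<in> \<Omega> \<longrightarrow> integrable sphere_borel (total_intensity u x)"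
proof -
  have I: "integrable (lborel \<Otimes>\<^sub>M sphere_borel) (\<lambda>(x, n). total_intensity u x n *\<^sub>R indicat_real \<Omega> x)"
    by (rule integrable_total_intensity[OF u _ sets_body bounded_body, where C = 1]) auto
  have "AE x in lborel. integrable sphere_borel (\<lambda>n. total_intensity u x n * indicat_real \<Omega> x)"
    using lborel_sphere.AE_integrable_fst'[OF I] by simp
  then show ?thesis by eventually_elim auto
qed

text \<open>
  Connects the real-valued intensity of the flux with the calculus of nonnegative integrals in which the
  Neumann series is summed.
\<close>

lemma ennreal_mean_intensity:
  assumes u: "integrable lborel u" and nonneg: "\<And>z. 0 \<le> u z"
  shows "AE x in lborel. x \<in> \<Omega> \<longrightarrow> ennreal (mean_intensity u x) =
    (\<integral>\<^sup>+n. ennreal (G n * transmission x n) \<partial>sphere_borel) +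
    (\<integral>\<^sup>+n. nn_ray_avg (\<lambda>z. ennreal (u z)) x n \<partial>sphere_borel)"
  using AE_integrable_total_intensity[OF u] AE_integrable_along_rays(2)[OF u]
proof eventually_elim
  case (elim x)
  have [measurable]: "u \<in> borel_measurable borel" using u by auto
  have ray: "0 \<le> ray_avg u x n" for n
    unfolding ray_avg_def by (intro integral_nonneg_AE) (auto simp: nonneg)
  have Gt: "0 \<le> G n * transmission x n" for n
    using G_nonneg transmission_bounds by simp
  show ?case
  proof
    assume "x \<in> \<Omega>"
    with elim(1) have "ennreal (mean_intensity u x) = (\<integral>\<^sup>+n. ennreal (total_intensity u x n) \<partial>sphere_borel)"
      unfolding mean_intensity_def
      by (intro nn_integral_eq_integral[symmetric]) (auto simp: total_intensity_def ray Gt)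
    also have "\<dots> = (\<integral>\<^sup>+n. ennreal (G n * transmission x n) + nn_ray_avg (\<lambda>z. ennreal (u z)) x n \<partial>sphere_borel)"
    proof (rule nn_integral_cong_AE)
      show "AE n in sphere_borel. ennreal (total_intensity u x n) =
          ennreal (G n * transmission x n) + nn_ray_avg (\<lambda>z. ennreal (u z)) x n"
        using elim(2)
      proof eventually_elim
        case (elim n)
        then have "nn_ray_avg (\<lambda>z. ennreal (u z)) x n = ennreal (ray_avg u x n)"
          unfolding nn_ray_avg_def ray_avg_def by (intro nn_integral_eq_integral) (auto simp: nonneg)
        then show ?case by (simp add: total_intensity_def ray Gt)
      qed
    qed
    also have "\<dots> = (\<integral>\<^sup>+n. ennreal (G n * transmission x n) \<partial>sphere_borel) +
        (\<integral>\<^sup>+n. nn_ray_avg (\<lambda>z. ennreal (u z)) x n \<partial>sphere_borel)"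
      by (rule nn_integral_add) measurable
    finally show "ennreal (mean_intensity u x) =
        (\<integral>\<^sup>+n. ennreal (G n * transmission x n) \<partial>sphere_borel) +
        (\<integral>\<^sup>+n. nn_ray_avg (\<lambda>z. ennreal (u z)) x n \<partial>sphere_borel)" .
  qed
qed

text \<open>
  Seen through the adjoint, the integral counts the photons emitted according to \<open>f\<close> that are absorbed
  inside \<open>\<Omega>\<close>. With \<open>d\<close> a bound on the diameter, absorption inside requires a path of length at most
  \<open>d\<close>, so \<open>q\<close> may be the probability of such a path.
\<close>

lemma scattering_contraction:
  obtains q where "0 \<le> q" "q < 1"
    "\<And>f. f \<in> borel_measurable borel \<Longrightarrow> (\<And>x. x \<notin> \<Omega> \<Longrightarrow> f x = 0) \<Longrightarrow>
      (\<integral>\<^sup>+x. (\<integral>\<^sup>+n. nn_ray_avg f x n \<partial>sphere_borel) * indicator \<Omega> x \<partial>lborel) \<le>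
      emeasure sphere_borel UNIV * (ennreal q * (\<integral>\<^sup>+x. f x \<partial>lborel))"
proof -
  obtain d where d: "\<And>x y. x \<in> \<Omega> \<Longrightarrow> y \<in> \<Omega> \<Longrightarrow> dist x y \<le> d"
    using bounded_body by (auto simp: bounded_two_points)
  define q where "q = measure path_length_law {..d}"
  have esc: "nn_ray_avg (indicator \<Omega>) z (- n) \<le> ennreal q" if "z \<in> \<Omega>" "norm n = 1" for z n
  proof -
    have "nn_ray_avg (indicator \<Omega>) z (- n) \<le> (\<integral>\<^sup>+t. indicator {..d} t \<partial>path_length_law)"
      unfolding nn_ray_avg_def
    proof (intro nn_integral_mono)
      fix t
      have "t \<le> d" if "z + t *\<^sub>R n \<in> \<Omega>"
        using d[OF \<open>z \<in> \<Omega>\<close> that] \<open>norm n = 1\<close> by (simp add: dist_norm)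
      then show "indicator \<Omega> (z - t *\<^sub>R - n) \<le> (indicator {..d} t :: ennreal)"
        by (auto simp: indicator_def)
    qed
    also have "\<dots> = ennreal q"
      by (simp add: q_def path_length.emeasure_eq_measure)
    finally show ?thesis .
  qed
  show ?thesis
  proof (rule that[of q])
    show "0 \<le> q" "q < 1" by (simp_all add: q_def measure_path_length_law_less_1)
    fix f :: "real^3 \<Rightarrow> ennreal"
    assume [measurable]: "f \<in> borel_measurable borel" and out: "\<And>x. x \<notin> \<Omega> \<Longrightarrow> f x = 0"
    have "(\<integral>\<^sup>+x. (\<integral>\<^sup>+n. nn_ray_avg f x n \<partial>sphere_borel) * indicator \<Omega> x \<partial>lborel) =
        (\<integral>\<^sup>+x. \<integral>\<^sup>+n. nn_ray_avg f x n * indicator \<Omega> x \<partial>sphere_borel \<partial>lborel)"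
      by (intro nn_integral_cong nn_integral_multc[symmetric]) measurable
    also have "\<dots> = (\<integral>\<^sup>+n. \<integral>\<^sup>+x. nn_ray_avg f x n * indicator \<Omega> x \<partial>lborel \<partial>sphere_borel)"
      by (rule lborel_sphere.Fubini'[symmetric]) measurable
    also have "\<dots> = (\<integral>\<^sup>+n. \<integral>\<^sup>+z. f z * nn_ray_avg (indicator \<Omega>) z (- n) \<partial>lborel \<partial>sphere_borel)"
      by (intro nn_integral_cong nn_ray_avg_adjoint) measurable
    also have "\<dots> \<le> (\<integral>\<^sup>+n. ennreal q * (\<integral>\<^sup>+z. f z \<partial>lborel) \<partial>sphere_borel)"
    proof (rule nn_integral_mono_AE)
      show "AE n in sphere_borel. (\<integral>\<^sup>+z. f z * nn_ray_avg (indicator \<Omega>) z (- n) \<partial>lborel) \<le> ennreal q * (\<integral>\<^sup>+z. f z \<partial>lborel)"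
        using AE_sphere_borel_norm
      proof eventually_elim
        case (elim n)
        have "f z * nn_ray_avg (indicator \<Omega>) z (- n) \<le> ennreal q * f z" for z
        proof (cases "z \<in> \<Omega>")
          case True
          show ?thesis
            by (subst mult.commute) (intro mult_right_mono esc[OF True elim], simp)
        qed (simp add: out)
        then have "(\<integral>\<^sup>+z. f z * nn_ray_avg (indicator \<Omega>) z (- n) \<partial>lborel) \<le> (\<integral>\<^sup>+z. ennreal q * f z \<partial>lborel)"
          by (intro nn_integral_mono) auto
        then show ?case by (simp add: nn_integral_cmult)
      qed
    qed
    also have "\<dots> = emeasure sphere_borel UNIV * (ennreal q * (\<integral>\<^sup>+x. f x \<partial>lborel))"
      by (simp add: mult.commute)
    finally show "(\<integral>\<^sup>+x. (\<integral>\<^sup>+n. nn_ray_avg f x n \<partial>sphere_borel) * indicator \<Omega> x \<partial>lborel) \<le>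
      emeasure sphere_borel UNIV * (ennreal q * (\<integral>\<^sup>+x. f x \<partial>lborel))" .
  qed
qed

text \<open>
  The incoming radiation cancels in the difference of two solutions, which is therefore bounded by its own
  scattered image. As scattering shrinks the \<open>L\<^sup>1\<close> norm by a factor below 1, this norm is 0.
\<close>

lemma radiative_equilibrium_unique:
  assumes u: "integrable lborel u" "\<And>x. x \<notin> \<Omega> \<Longrightarrow> u x = 0"
      "AE x in lborel. x \<in> \<Omega> \<longrightarrow> measure sphere_borel UNIV * u x = mean_intensity u x"
    and u': "integrable lborel u'" "\<And>x. x \<notin> \<Omega> \<Longrightarrow> u' x = 0"
      "AE x in lborel. x \<in> \<Omega> \<longrightarrow> measure sphere_borel UNIV * u' x = mean_intensity u' x"
  shows "AE x in lborel. u x = u' x"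
proof -
  let ?m = "measure sphere_borel UNIV"
  define f where "f x = ennreal \<bar>u x - u' x\<bar>" for x
  have [measurable]: "u \<in> borel_measurable borel" "u' \<in> borel_measurable borel" using u u' by auto
  have f [measurable]: "f \<in> borel_measurable borel" unfolding f_def by measurable
  have M: "emeasure sphere_borel UNIV = ennreal ?m"
    by (simp add: sphere_borel.emeasure_eq_measure)
  then have m: "?m > 0" using emeasure_sphere_borel_bounds(2) by simp
  obtain q where q: "0 \<le> q" "q < 1"
    "\<And>f. f \<in> borel_measurable borel \<Longrightarrow> (\<And>x. x \<notin> \<Omega> \<Longrightarrow> f x = 0) \<Longrightarrow>
      (\<integral>\<^sup>+x. (\<integral>\<^sup>+n. nn_ray_avg f x n \<partial>sphere_borel) * indicator \<Omega> x \<partial>lborel) \<le>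
      emeasure sphere_borel UNIV * (ennreal q * (\<integral>\<^sup>+x. f x \<partial>lborel))"
    by (rule scattering_contraction) blast
  have "AE x in lborel. ennreal ?m * f x \<le> (\<integral>\<^sup>+n. nn_ray_avg f x n \<partial>sphere_borel) * indicator \<Omega> x"
    using u(3) u'(3) AE_integrable_total_intensity[OF u(1)] AE_integrable_total_intensity[OF u'(1)]
      AE_integrable_along_rays(2)[OF u(1)] AE_integrable_along_rays(2)[OF u'(1)]
  proof eventually_elim
    case (elim x)
    show ?case
    proof (cases "x \<in> \<Omega>")
      case True
      have i: "integrable sphere_borel (\<lambda>n. total_intensity u x n - total_intensity u' x n)"
        using elim(3,4) True by simp
      have diff: "?m * (u x - u' x) = (LINT n|sphere_borel. total_intensity u x n - total_intensity u' x n)"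
        using elim True by (simp add: mean_intensity_def right_diff_distrib)
      have "ennreal ?m * f x = ennreal \<bar>?m * (u x - u' x)\<bar>"
        using m by (simp add: f_def abs_mult ennreal_mult')
      also have "\<dots> = ennreal (norm (LINT n|sphere_borel. total_intensity u x n - total_intensity u' x n))"
        unfolding diff by simp
      also have "\<dots> \<le> (\<integral>\<^sup>+n. ennreal (norm (total_intensity u x n - total_intensity u' x n)) \<partial>sphere_borel)"
        by (rule integral_norm_bound_ennreal[OF i])
      also have "\<dots> \<le> (\<integral>\<^sup>+n. nn_ray_avg f x n \<partial>sphere_borel)"
      proof (rule nn_integral_mono_AE)
        show "AE n in sphere_borel. ennreal (norm (total_intensity u x n - total_intensity u' x n)) \<le> nn_ray_avg f x n"
          using elim(5,6)
        proof eventually_elim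
          case (elim n)
          then have "total_intensity u x n - total_intensity u' x n = ray_avg (\<lambda>z. u z - u' z) x n"
            by (simp add: total_intensity_def ray_avg_def)
          then show ?case
            using ennreal_ray_avg_le[of "\<lambda>z. u z - u' z" x n] by (simp add: f_def[abs_def])
        qed
      qed
      finally show ?thesis using True by simp
    qed (use u(2) u'(2) in \<open>simp add: f_def\<close>)
  qed
  then have "(\<integral>\<^sup>+x. ennreal ?m * f x \<partial>lborel) \<le> (\<integral>\<^sup>+x. (\<integral>\<^sup>+n. nn_ray_avg f x n \<partial>sphere_borel) * indicator \<Omega> x \<partial>lborel)"
    by (rule nn_integral_mono_AE)
  also have "\<dots> \<le> ennreal ?m * (ennreal q * (\<integral>\<^sup>+x. f x \<partial>lborel))"
    using q(3)[of f] u(2) u'(2) by (simp add: f_def M)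
  finally have le: "ennreal ?m * (\<integral>\<^sup>+x. f x \<partial>lborel) \<le> ennreal ?m * (ennreal q * (\<integral>\<^sup>+x. f x \<partial>lborel))"
    by (simp add: nn_integral_cmult)
  have "integrable lborel (\<lambda>x. u x - u' x)" using u(1) u'(1) by simp
  then have fin: "(\<integral>\<^sup>+x. f x \<partial>lborel) < \<infinity>"
    by (simp add: f_def integrable_iff_bounded)
  then obtain I where I: "(\<integral>\<^sup>+x. f x \<partial>lborel) = ennreal I" "0 \<le> I"
    by (cases "(\<integral>\<^sup>+x. f x \<partial>lborel)") auto
  with le m q(1) have "?m * I \<le> ?m * (q * I)"
    by (simp add: ennreal_mult'[symmetric])
  then have "I \<le> q * I" using m by simp
  then have "(1 - q) * I \<le> 0" by (simp add: algebra_simps)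
  then have "I = 0" using q(2) I(2) by (simp add: mult_le_0_iff)
  with I(1) have "(\<integral>\<^sup>+x. f x \<partial>lborel) = 0" by simp
  then have "AE x in lborel. f x = 0"
    by (subst (asm) nn_integral_0_iff_AE) auto
  then show ?thesis by eventually_elim (simp add: f_def)
qed

lemma total_intensity_nonneg: "(\<And>z. 0 \<le> u z) \<Longrightarrow> 0 \<le> total_intensity u x n"
  unfolding total_intensity_def ray_avg_def
  by (intro add_nonneg_nonneg mult_nonneg_nonneg integral_nonneg_AE G_nonneg transmission_bounds) auto

lemma transmission_pos: "x \<in> \<Omega> \<Longrightarrow> norm n = 1 \<Longrightarrow> 0 < transmission x n"
  unfolding transmission_def
  by (subst exp_entry_dist[OF open_body convex_body bounded_body, symmetric]) auto

text \<open>
  The solution is the Neumann series of the source: \<open>v i\<close> is the emission of energy that has already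
  been emitted and absorbed again \<open>i\<close> times. In extended nonnegative reals the series converges and solves the fixed point
  equation everywhere; the contraction shows that its integral is finite, so it is finite almost everywhere.
\<close>

lemma radiative_equilibrium_exists:
  obtains u where "integrable lborel u" "\<And>x. 0 \<le> u x" "\<And>x. x \<notin> \<Omega> \<Longrightarrow> u x = 0"
    "AE x in lborel. x \<in> \<Omega> \<longrightarrow> measure sphere_borel UNIV * u x = mean_intensity u x"
    "(LINT n|sphere_borel. G n) > 0 \<Longrightarrow> AE x in lborel. x \<in> \<Omega> \<longrightarrow> 0 < u x"
proof -
  let ?m = "measure sphere_borel UNIV"
  have M: "emeasure sphere_borel UNIV = ennreal ?m"
    by (simp add: sphere_borel.emeasure_eq_measure)
  then have m: "?m > 0" using emeasure_sphere_borel_bounds(2) by simp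
  have inv: "ennreal ?m * ennreal (1 / ?m) = 1"
    using m by (simp flip: ennreal_mult')
  define source where
    "source x = ennreal (1 / ?m) * ((\<integral>\<^sup>+n. ennreal (G n * transmission x n) \<partial>sphere_borel) * indicator \<Omega> x)" for x
  define scatter where
    "scatter f x = ennreal (1 / ?m) * ((\<integral>\<^sup>+n. nn_ray_avg f x n \<partial>sphere_borel) * indicator \<Omega> x)"
    for f :: "real^3 \<Rightarrow> ennreal" and x
  define v where "v = rec_nat source (\<lambda>_. scatter)"
  have v: "v 0 = source" "\<And>i. v (Suc i) = scatter (v i)" by (simp_all add: v_def)
  have m_source [measurable]: "source \<in> borel_measurable borel"
    unfolding source_def[abs_def] by measurable
  have m_scatter [measurable]: "scatter f \<in> borel_measurable borel"
    if [measurable]: "f \<in> borel_measurable borel" for f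
    unfolding scatter_def[abs_def] by measurable
  have m_v [measurable]: "v i \<in> borel_measurable borel" for i
    by (induction i) (auto simp: v)
  have v_out: "v i x = 0" if "x \<notin> \<Omega>" for i x
    using that by (cases i) (auto simp: v source_def scatter_def)
  obtain q where q: "0 \<le> q" "q < 1"
    "\<And>f. f \<in> borel_measurable borel \<Longrightarrow> (\<And>x. x \<notin> \<Omega> \<Longrightarrow> f x = 0) \<Longrightarrow>
      (\<integral>\<^sup>+x. (\<integral>\<^sup>+n. nn_ray_avg f x n \<partial>sphere_borel) * indicator \<Omega> x \<partial>lborel) \<le>
      emeasure sphere_borel UNIV * (ennreal q * (\<integral>\<^sup>+x. f x \<partial>lborel))"
    by (rule scattering_contraction) blast
  have step: "(\<integral>\<^sup>+x. v (Suc i) x \<partial>lborel) \<le> ennreal q * (\<integral>\<^sup>+x. v i x \<partial>lborel)" for i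
  proof -
    have "(\<integral>\<^sup>+x. v (Suc i) x \<partial>lborel) =
       ennreal (1 / ?m) * (\<integral>\<^sup>+x. (\<integral>\<^sup>+n. nn_ray_avg (v i) x n \<partial>sphere_borel) * indicator \<Omega> x \<partial>lborel)"
      unfolding v scatter_def by (rule nn_integral_cmult) measurable
    also have "\<dots> \<le> ennreal (1 / ?m) * (ennreal ?m * (ennreal q * (\<integral>\<^sup>+x. v i x \<partial>lborel)))"
      unfolding M[symmetric] by (intro mult_left_mono q(3) m_v v_out) auto
    finally show ?thesis
      using inv by (simp add: mult.assoc[symmetric] mult.commute[of "ennreal (1 / ?m)"])
  qed
  have geometric: "(\<integral>\<^sup>+x. v i x \<partial>lborel) \<le> ennreal (q ^ i) * (\<integral>\<^sup>+x. source x \<partial>lborel)" for i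
  proof (induction i)
    case (Suc i)
    have "(\<integral>\<^sup>+x. v (Suc i) x \<partial>lborel) \<le> ennreal q * (ennreal (q ^ i) * (\<integral>\<^sup>+x. source x \<partial>lborel))"
      by (rule order_trans[OF step]) (intro mult_left_mono Suc, simp)
    then show ?case using q(1) by (simp add: mult.assoc[symmetric] ennreal_mult'[symmetric])
  qed (simp add: v)
  have source_fin: "(\<integral>\<^sup>+x. source x \<partial>lborel) < \<infinity>"
  proof -
    have "(\<integral>\<^sup>+x. source x \<partial>lborel) \<le>
       (\<integral>\<^sup>+x. ennreal (1 / ?m) * ((\<integral>\<^sup>+n. ennreal (G n) \<partial>sphere_borel) * indicator \<Omega> x) \<partial>lborel)"
      unfolding source_def
    proof (intro nn_integral_mono mult_left_mono mult_right_mono ennreal_leI)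
      show "G n * transmission x n \<le> G n" for x n
        using G_nonneg[of n] transmission_bounds(2)[of x n] by (simp add: mult_left_le)
    qed auto
    also have "\<dots> = ennreal (1 / ?m) * ((\<integral>\<^sup>+n. ennreal (G n) \<partial>sphere_borel) * emeasure lborel \<Omega>)"
      by (subst nn_integral_cmult, measurable, subst nn_integral_cmult) auto
    also have "\<dots> < \<infinity>"
      using integrable_G G_nonneg emeasure_bounded_finite[OF bounded_body]
      by (auto simp: integrable_iff_bounded ennreal_mult_less_top)
    finally show ?thesis .
  qed
  define U where "U x = (\<Sum>i. v i x)" for x
  have m_U [measurable]: "U \<in> borel_measurable borel" unfolding U_def[abs_def] by measurable
  have U_fin: "(\<integral>\<^sup>+x. U x \<partial>lborel) < \<infinity>"
  proof -
    have "(\<integral>\<^sup>+x. U x \<partial>lborel) = (\<Sum>i. \<integral>\<^sup>+x. v i x \<partial>lborel)"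
      unfolding U_def by (rule nn_integral_suminf) measurable
    also have "\<dots> \<le> (\<Sum>i. ennreal (q ^ i) * (\<integral>\<^sup>+x. source x \<partial>lborel))"
      by (intro suminf_le geometric) auto
    also have "\<dots> = (\<Sum>i. ennreal (q ^ i)) * (\<integral>\<^sup>+x. source x \<partial>lborel)"
      by (rule ennreal_suminf_multc)
    also have "(\<Sum>i. ennreal (q ^ i)) = ennreal (\<Sum>i. q ^ i)"
      using q by (intro suminf_ennreal2 summable_geometric) auto
    also have "ennreal (\<Sum>i. q ^ i) * (\<integral>\<^sup>+x. source x \<partial>lborel) < \<infinity>"
      using source_fin by (simp add: ennreal_mult_less_top)
    finally show ?thesis .
  qed
  have U_eq: "U x = source x + scatter U x" for x
  proof -
    have "scatter U x = (\<Sum>i. scatter (v i) x)"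
    proof -
      have "nn_ray_avg U x n = (\<Sum>i. nn_ray_avg (v i) x n)" for n
        unfolding nn_ray_avg_def U_def by (rule nn_integral_suminf) measurable
      then have "(\<integral>\<^sup>+n. nn_ray_avg U x n \<partial>sphere_borel) = (\<Sum>i. \<integral>\<^sup>+n. nn_ray_avg (v i) x n \<partial>sphere_borel)"
        by (simp add: nn_integral_suminf)
      then show ?thesis by (simp add: scatter_def ennreal_suminf_cmult ennreal_suminf_multc)
    qed
    also have "\<dots> = (\<Sum>i. v (Suc i) x)" by (simp add: v)
    finally have "(\<lambda>i. v (Suc i) x) sums scatter U x" by (simp add: summable_sums)
    then have "(\<lambda>i. v i x) sums (scatter U x + v 0 x)" by (rule sums_Suc)
    then show ?thesis by (simp add: U_def sums_unique[symmetric] v add.commute)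
  qed
  have U_out: "U x = 0" if "x \<notin> \<Omega>" for x using v_out[OF that] by (simp add: U_def)
  define u where "u x = enn2real (U x)" for x
  have [measurable]: "u \<in> borel_measurable borel" unfolding u_def by measurable
  have "AE x in lborel. U x \<noteq> \<infinity>"
    using U_fin by (intro nn_integral_PInf_AE) auto
  then have uU: "AE x in lborel. ennreal (u x) = U x"
    by eventually_elim (simp add: u_def less_top)
  have u_int: "integrable lborel u"
  proof (rule integrableI_nonneg)
    have "(\<integral>\<^sup>+x. ennreal (u x) \<partial>lborel) = (\<integral>\<^sup>+x. U x \<partial>lborel)"
      by (rule nn_integral_cong_AE[OF uU])
    then show "(\<integral>\<^sup>+x. ennreal (u x) \<partial>lborel) < \<infinity>" using U_fin by simp
  qed (auto simp: u_def)
  have u_nonneg: "0 \<le> u x" for x by (simp add: u_def)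
  show ?thesis
  proof (rule that[of u])
    show "0 \<le> u x" for x by (rule u_nonneg)
    show "u x = 0" if "x \<notin> \<Omega>" for x using U_out[OF that] by (simp add: u_def)
    show "AE x in lborel. x \<in> \<Omega> \<longrightarrow> ?m * u x = mean_intensity u x"
      using uU AE_along_rays[OF uU] ennreal_mean_intensity[OF u_int u_nonneg]
    proof eventually_elim
      case (elim x)
      show ?case
      proof
        assume x: "x \<in> \<Omega>"
        have "(\<integral>\<^sup>+n. nn_ray_avg (\<lambda>z. ennreal (u z)) x n \<partial>sphere_borel) = (\<integral>\<^sup>+n. nn_ray_avg U x n \<partial>sphere_borel)"
          by (rule nn_integral_cong_AE)
             (use elim(2) in \<open>auto simp: nn_ray_avg_def elim!: eventually_mono intro!: nn_integral_cong_AE\<close>)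
        with elim(3) x have "ennreal (mean_intensity u x) = (ennreal ?m * ennreal (1 / ?m)) *
            ((\<integral>\<^sup>+n. ennreal (G n * transmission x n) \<partial>sphere_borel) + (\<integral>\<^sup>+n. nn_ray_avg U x n \<partial>sphere_borel))"
          by (simp add: inv)
        also have "\<dots> = ennreal ?m * (source x + scatter U x)"
          using x by (simp add: source_def scatter_def distrib_left mult.assoc)
        also have "\<dots> = ennreal (?m * u x)"
          using m elim(1) by (simp add: U_eq[symmetric] ennreal_mult')
        finally have "ennreal (mean_intensity u x) = ennreal (?m * u x)" .
        moreover have "0 \<le> mean_intensity u x"
          unfolding mean_intensity_def
          by (intro integral_nonneg_AE AE_I2 total_intensity_nonneg) (simp add: u_def)
        ultimately show "?m * u x = mean_intensity u x"
          using m by (simp add: u_def)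
      qed
    qed
    show "AE x in lborel. x \<in> \<Omega> \<longrightarrow> 0 < u x" if pos: "(LINT n|sphere_borel. G n) > 0"
      using uU
    proof eventually_elim
      case (elim x)
      show ?case
      proof
        assume x: "x \<in> \<Omega>"
        have "(\<integral>\<^sup>+n. ennreal (G n * transmission x n) \<partial>sphere_borel) \<noteq> 0"
        proof
          assume "(\<integral>\<^sup>+n. ennreal (G n * transmission x n) \<partial>sphere_borel) = 0"
          then have "AE n in sphere_borel. ennreal (G n * transmission x n) = 0"
            by (subst (asm) nn_integral_0_iff_AE) measurable
          with AE_sphere_borel_norm have "AE n in sphere_borel. G n = 0"
          proof eventually_elim
            case (elim n)
            then show ?case
              using transmission_pos[OF x elim(1)] G_nonneg[of n]
              by (auto simp: ennreal_eq_0_iff mult_le_0_iff)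
          qed
          then have "(LINT n|sphere_borel. G n) = 0" by (rule integral_eq_zero_AE)
          with pos show False by simp
        qed
        then have "source x \<noteq> 0" using x m by (simp add: source_def)
        then have "U x \<noteq> 0" by (simp add: U_eq[of x])
        with elim show "0 < u x" by (metis ennreal_eq_0_iff not_less)
      qed
    qed
  qed (rule u_int)
qed

end

section \<open>From spectral to total flux\<close>

interpretation lborel_frequency_sphere: pair_sigma_finite "lborel :: real measure" sphere_borel ..

text \<open>
  The two fields must be measurable on \<open>\<Omega>\<close>, because integrability includes measurability and does not
  transfer along equality almost everywhere.
\<close>

lemma divergence_free_on_cong_AE:
  assumes F: "(\<lambda>x. indicat_real \<Omega> x *\<^sub>R F x) \<in> borel_measurable borel"
    and F': "(\<lambda>x. indicat_real \<Omega> x *\<^sub>R F' x) \<in> borel_measurable borel"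
    and eq: "AE x in lborel. x \<in> \<Omega> \<longrightarrow> F x = F' x"
  shows "divergence_free_on \<Omega> F \<longleftrightarrow> divergence_free_on \<Omega> F'"
proof -
  have K: "set_integrable lborel K F \<longleftrightarrow> set_integrable lborel K F'" if "compact K" "K \<subseteq> \<Omega>" for K
  proof -
    have [measurable]: "K \<in> sets borel" using that by (simp add: compact_imp_closed)
    have restrict: "indicat_real K x *\<^sub>R H x = indicat_real K x *\<^sub>R (indicat_real \<Omega> x *\<^sub>R H x)"
      for x and H :: "real^3 \<Rightarrow> real^3"
      using that(2) by (auto simp: indicator_def)
    show ?thesis
      unfolding set_integrable_def
    proof (rule integrable_cong_AE)
      show "(\<lambda>x. indicat_real K x *\<^sub>R F x) \<in> borel_measurable lborel"
        unfolding restrict[of _ F] using F by measurable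
      show "(\<lambda>x. indicat_real K x *\<^sub>R F' x) \<in> borel_measurable lborel"
        unfolding restrict[of _ F'] using F' by measurable
      show "AE x in lborel. indicat_real K x *\<^sub>R F x = indicat_real K x *\<^sub>R F' x"
        using eq by eventually_elim (use that(2) in \<open>auto simp: indicator_def\<close>)
    qed
  qed
  have D: "(LINT x:\<Omega>|lborel. frechet_derivative \<phi> (at x) (F x)) = (LINT x:\<Omega>|lborel. frechet_derivative \<phi> (at x) (F' x))"
    if \<phi>: "test_function \<Omega> \<phi>" for \<phi>
  proof -
    have "Ck (Suc 0) \<phi>" using \<phi> unfolding test_function_def by blast
    then have "linear (frechet_derivative \<phi> (at x))" for x
      by (auto intro: linear_frechet_derivative)
    then have restrict: "indicat_real \<Omega> x *\<^sub>R frechet_derivative \<phi> (at x) (H x) =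
        frechet_derivative \<phi> (at x) (indicat_real \<Omega> x *\<^sub>R H x)" for x and H :: "real^3 \<Rightarrow> real^3"
      by (simp add: linear_cmul)
    show ?thesis
      unfolding set_lebesgue_integral_def
    proof (rule integral_cong_AE)
      show "(\<lambda>x. indicat_real \<Omega> x *\<^sub>R frechet_derivative \<phi> (at x) (F x)) \<in> borel_measurable lborel"
        unfolding restrict using F by (intro measurable_test_function_derivative[OF \<phi>]) auto
      show "(\<lambda>x. indicat_real \<Omega> x *\<^sub>R frechet_derivative \<phi> (at x) (F' x)) \<in> borel_measurable lborel"
        unfolding restrict using F' by (intro measurable_test_function_derivative[OF \<phi>]) auto
      show "AE x in lborel. indicat_real \<Omega> x *\<^sub>R frechet_derivative \<phi> (at x) (F x) =
          indicat_real \<Omega> x *\<^sub>R frechet_derivative \<phi> (at x) (F' x)"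
        using eq by eventually_elim (auto simp: indicator_def)
    qed
  qed
  show ?thesis unfolding divergence_free_on_def using K D by auto
qed

locale radiative_transfer =
  fixes h c k :: real and \<Omega> :: "(real^3) set" and g :: "real \<Rightarrow> real^3 \<Rightarrow> real"
  assumes h_pos: "h > 0" and c_pos: "c > 0" and k_pos: "k > 0"
    and open_domain: "open \<Omega>" and convex_domain: "convex \<Omega>" and bounded_domain: "bounded \<Omega>"
    and g_measurable: "set_borel_measurable borel ({0<..} \<times> sphere 0 1) (\<lambda>(\<nu>, n). g \<nu> n)"
    and g_nonneg: "\<And>\<nu> n. \<nu> > 0 \<Longrightarrow> n \<in> sphere 0 1 \<Longrightarrow> g \<nu> n \<ge> 0"
    and energy_finite: "boundary_energy g < \<infinity>"
begin

text \<open>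
  Setting \<open>g\<close> to zero off the physical range makes it measurable and nonnegative everywhere.
\<close>

definition incoming :: "real \<Rightarrow> real^3 \<Rightarrow> real" where
  "incoming \<nu> n = indicat_real ({0<..} \<times> sphere 0 1) (\<nu>, n) * g \<nu> n"

lemma incoming_measurable [measurable (raw)]:
  assumes [measurable]: "f \<in> borel_measurable M" "d \<in> borel_measurable M"
  shows "(\<lambda>p. incoming (f p) (d p)) \<in> borel_measurable M"
proof -
  have "(\<lambda>(\<nu>, n). incoming \<nu> n) \<in> borel_measurable borel"
    using g_measurable by (simp add: set_borel_measurable_def incoming_def case_prod_unfold)
  then have [measurable]: "(\<lambda>(\<nu>, n). incoming \<nu> n) \<in> borel_measurable (borel \<Otimes>\<^sub>M borel)"
    by (simp add: borel_prod)
  have "(\<lambda>p. case (f p, d p) of (\<nu>, n) \<Rightarrow> incoming \<nu> n) \<in> borel_measurable M"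
    by measurable
  then show ?thesis by simp
qed

lemma incoming_nonneg: "0 \<le> incoming \<nu> n"
  using g_nonneg[of \<nu> n] by (auto simp: incoming_def indicator_def)

definition nn_incoming :: "real^3 \<Rightarrow> ennreal" where
  "nn_incoming n = (\<integral>\<^sup>+\<nu>. ennreal (incoming \<nu> n) \<partial>lborel)"

definition incoming_total :: "real^3 \<Rightarrow> real" where
  "incoming_total n = enn2real (nn_incoming n)"

lemma nn_incoming_measurable [measurable]: "nn_incoming \<in> borel_measurable borel"
  unfolding nn_incoming_def[abs_def] by measurable

lemma incoming_total_measurable [measurable]: "incoming_total \<in> borel_measurable borel"
  unfolding incoming_total_def[abs_def] by measurable

lemma boundary_energy_eq: "boundary_energy g = (\<integral>\<^sup>+n. nn_incoming n \<partial>sphere_borel)"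
  unfolding boundary_energy_def
proof (rule nn_integral_sphere_measure)
  fix n :: "real^3" assume "norm n = 1"
  then show "(\<integral>\<^sup>+\<nu>\<in>{0<..}. ennreal (g \<nu> n) \<partial>lborel) = nn_incoming n"
    unfolding nn_incoming_def
    by (intro nn_integral_cong) (auto simp: incoming_def indicator_def)
qed measurable

lemma AE_incoming_total: "AE n in sphere_borel. nn_incoming n = ennreal (incoming_total n)"
proof -
  have "AE n in sphere_borel. nn_incoming n \<noteq> \<infinity>"
    using energy_finite unfolding boundary_energy_eq by (intro nn_integral_PInf_AE) auto
  then show ?thesis
    by eventually_elim (simp add: incoming_total_def less_top)
qed

lemma nn_integral_incoming_total:
  "(\<integral>\<^sup>+n. ennreal (incoming_total n) \<partial>sphere_borel) = boundary_energy g"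
  unfolding boundary_energy_eq
  by (intro nn_integral_cong_AE) (use AE_incoming_total in \<open>auto elim: eventually_mono\<close>)

lemma integrable_incoming_total: "integrable sphere_borel incoming_total"
  by (rule integrableI_nonneg)
     (auto simp: incoming_total_def[symmetric] nn_integral_incoming_total energy_finite[simplified],
      simp add: incoming_total_def)

sublocale radiative_body \<Omega> incoming_total
  by unfold_locales
     (auto simp: open_domain convex_domain bounded_domain integrable_incoming_total,
      simp add: incoming_total_def)

text \<open>
  The intensity on \<open>\<Omega>\<close> written with ray averages, and extended to all points, directions and frequencies so
  that it is measurable in all of them jointly.
\<close>

definition spectral_intensity :: "(real^3 \<Rightarrow> real) \<Rightarrow> real \<Rightarrow> real^3 \<Rightarrow> real^3 \<Rightarrow> real" where
  "spectral_intensity W \<nu> x n = indicat_real {0<..} \<nu> *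
     (incoming \<nu> n * transmission x n + ray_avg (\<lambda>z. planck h c k \<nu> (W z)) x n)"

lemma spectral_intensity_measurable [measurable (raw)]:
  assumes [measurable]: "W \<in> borel_measurable borel" "e \<in> borel_measurable M" "f \<in> borel_measurable M" "d \<in> borel_measurable M"
  shows "(\<lambda>p. spectral_intensity W (e p) (f p) (d p)) \<in> borel_measurable M"
  unfolding spectral_intensity_def ray_avg_def by measurable

definition spectral_flux :: "(real^3 \<Rightarrow> real) \<Rightarrow> real^3 \<Rightarrow> real^3" where
  "spectral_flux W x = (LINT \<nu>|lborel. LINT n|sphere_borel. spectral_intensity W \<nu> x n *\<^sub>R n)"

lemma spectral_flux_measurable [measurable]:
  assumes [measurable]: "W \<in> borel_measurable borel"
  shows "spectral_flux W \<in> borel_measurable borel"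
  unfolding spectral_flux_def[abs_def] by measurable

lemma flux_eq_spectral_flux:
  assumes [measurable]: "(\<lambda>z. indicat_real \<Omega> z * T z) \<in> borel_measurable borel" and x: "x \<in> \<Omega>"
  shows "flux h c k \<Omega> g T x = spectral_flux (\<lambda>z. indicat_real \<Omega> z * T z) x"
  unfolding flux_def spectral_flux_def set_lebesgue_integral_def
proof (rule Bochner_Integration.integral_cong[OF refl])
  fix \<nu> :: real
  let ?S = "\<lambda>n. spectral_intensity (\<lambda>z. indicat_real \<Omega> z * T z) \<nu> x n *\<^sub>R n"
  show "indicat_real {0<..} \<nu> *\<^sub>R (LINT n|sphere_measure. intensity h c k \<Omega> g T \<nu> x n *\<^sub>R n) = (LINT n|sphere_borel. ?S n)"
  proof (cases "\<nu> > 0")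
    case True
    have "(LINT n|sphere_measure. intensity h c k \<Omega> g T \<nu> x n *\<^sub>R n) = (LINT n|sphere_borel. ?S n)"
    proof (rule integral_sphere_measure)
      fix n :: "real^3" assume n: "norm n = 1"
      show "intensity h c k \<Omega> g T \<nu> x n *\<^sub>R n = ?S n"
        using intensity_eq_ray_avg[OF open_domain convex_domain bounded_domain x n assms(1), of h c k g \<nu>] True n
        by (simp add: spectral_intensity_def transmission_def incoming_def)
    qed measurable
    with True show ?thesis by simp
  qed (simp add: spectral_intensity_def)
qed

lemma spectral_flux_cong_AE:
  assumes [measurable]: "W \<in> borel_measurable borel" "W' \<in> borel_measurable borel"
    and eq: "AE z in lborel. W z = W' z"
  shows "AE x in lborel. spectral_flux W x = spectral_flux W' x"
  using AE_along_rays[OF eq]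
proof eventually_elim
  case (elim x)
  have "(LINT n|sphere_borel. spectral_intensity W \<nu> x n *\<^sub>R n) =
        (LINT n|sphere_borel. spectral_intensity W' \<nu> x n *\<^sub>R n)" for \<nu>
  proof (rule integral_cong_AE)
    show "AE n in sphere_borel. spectral_intensity W \<nu> x n *\<^sub>R n = spectral_intensity W' \<nu> x n *\<^sub>R n"
      using elim
    proof eventually_elim
      case (elim n)
      have "ray_avg (\<lambda>z. planck h c k \<nu> (W z)) x n = ray_avg (\<lambda>z. planck h c k \<nu> (W' z)) x n"
        unfolding ray_avg_def
        by (rule integral_cong_AE) (use elim in \<open>auto elim: eventually_mono\<close>)
      then show ?case by (simp add: spectral_intensity_def)
    qed
  qed measurable
  then show ?case by (simp add: spectral_flux_def)
qed

definition emission :: "(real^3 \<Rightarrow> real) \<Rightarrow> real^3 \<Rightarrow> real" where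
  "emission W z = radiation_constant h c k * W z ^ 4"

lemma emission_measurable [measurable]: "W \<in> borel_measurable borel \<Longrightarrow> emission W \<in> borel_measurable borel"
  unfolding emission_def[abs_def] by measurable

lemma emission_nonneg: "0 \<le> emission W z"
  using radiation_constant_pos[OF h_pos c_pos k_pos] by (simp add: emission_def)

text \<open>
  All integrands are nonnegative, so by Tonelli's theorem the frequency can be integrated first, which
  replaces Planck's law by its fourth power. To turn this into an identity of vector-valued integrals the
  total must be finite, which holds for almost every \<open>x\<close> because the emission is integrable.
\<close>

lemma spectral_flux_eq_total_flux:
  assumes [measurable]: "W \<in> borel_measurable borel" and nonneg: "\<And>z. 0 \<le> W z"
    and u: "integrable lborel (emission W)"
  shows "AE x in lborel. spectral_flux W x = total_flux (emission W) x"
  using AE_integrable_along_rays(1)[OF u]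
proof eventually_elim
  case (elim x)
  have u_abs: "ennreal \<bar>emission W z\<bar> = ennreal (emission W z)" for z
    by (simp add: emission_nonneg)
  have fin: "(\<integral>\<^sup>+n. nn_ray_avg (\<lambda>z. ennreal (emission W z)) x n \<partial>sphere_borel) < \<infinity>"
    using elim unfolding u_abs .
  let ?B = "\<lambda>\<nu> z. planck h c k \<nu> (W z)"
  let ?H = "\<lambda>\<nu> n. spectral_intensity W \<nu> x n"
  have B: "0 \<le> ?B \<nu> z" if "\<nu> > 0" for \<nu> z
    by (rule planck_nonneg[OF h_pos k_pos that nonneg])
  have ray_nonneg: "0 \<le> ray_avg (?B \<nu>) x n" if "\<nu> > 0" for \<nu> n
    unfolding ray_avg_def by (intro integral_nonneg_AE) (auto simp: B that)
  have H_nonneg: "0 \<le> ?H \<nu> n" for \<nu> n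
    using incoming_nonneg[of \<nu> n] transmission_bounds[of x n] ray_nonneg[of \<nu> n]
    by (auto simp: spectral_intensity_def indicator_def)
  have total: "AE n in sphere_borel. (\<integral>\<^sup>+\<nu>. ennreal (?H \<nu> n) \<partial>lborel) = ennreal (total_intensity (emission W) x n)"
  proof -
    have "AE n in sphere_borel. nn_ray_avg (\<lambda>z. ennreal (emission W z)) x n \<noteq> \<infinity>"
      using fin by (intro nn_integral_PInf_AE) auto
    with AE_incoming_total show ?thesis
    proof eventually_elim
      case (elim n)
      have swap: "(\<integral>\<^sup>+\<nu>. (\<integral>\<^sup>+t. ennreal (?B \<nu> (x - t *\<^sub>R n)) * indicator {0<..} \<nu> \<partial>path_length_law) \<partial>lborel) =
          nn_ray_avg (\<lambda>z. ennreal (emission W z)) x n"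
        unfolding nn_ray_avg_def emission_def
        by (subst lborel_path.Fubini'[symmetric])
           (auto simp: nn_integral_planck[OF h_pos c_pos k_pos nonneg])
      then have "AE \<nu> in lborel. (\<integral>\<^sup>+t. ennreal (?B \<nu> (x - t *\<^sub>R n)) * indicator {0<..} \<nu> \<partial>path_length_law) \<noteq> \<infinity>"
        using elim(2) by (intro nn_integral_PInf_AE) auto
      then have ray: "AE \<nu> in lborel. (\<integral>\<^sup>+t. ennreal (?B \<nu> (x - t *\<^sub>R n)) * indicator {0<..} \<nu> \<partial>path_length_law) =
          ennreal (ray_avg (?B \<nu>) x n) * indicator {0<..} \<nu>"
      proof eventually_elim
        case (elim \<nu>)
        show ?case
        proof (cases "\<nu> > 0")
          case True
          with elim have "integrable path_length_law (\<lambda>t. ?B \<nu> (x - t *\<^sub>R n))"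
            by (intro integrableI_nonneg) (auto simp: B less_top)
          with True show ?thesis
            unfolding ray_avg_def by (simp add: nn_integral_eq_integral B)
        qed simp
      qed
      have "(\<integral>\<^sup>+\<nu>. ennreal (?H \<nu> n) \<partial>lborel) =
         (\<integral>\<^sup>+\<nu>. ennreal (incoming \<nu> n) * ennreal (transmission x n) +
            ennreal (ray_avg (?B \<nu>) x n) * indicator {0<..} \<nu> \<partial>lborel)"
      proof (rule nn_integral_cong)
        fix \<nu>
        show "ennreal (?H \<nu> n) = ennreal (incoming \<nu> n) * ennreal (transmission x n) +
            ennreal (ray_avg (?B \<nu>) x n) * indicator {0<..} \<nu>"
        proof (cases "\<nu> > 0")
          case True
          then show ?thesis
            using incoming_nonneg[of \<nu> n] transmission_bounds[of x n] ray_nonneg[OF True, of n]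
            by (simp add: spectral_intensity_def ennreal_mult)
        qed (simp add: spectral_intensity_def incoming_def)
      qed
      also have "\<dots> = (\<integral>\<^sup>+\<nu>. ennreal (incoming \<nu> n) * ennreal (transmission x n) \<partial>lborel) +
          (\<integral>\<^sup>+\<nu>. ennreal (ray_avg (?B \<nu>) x n) * indicator {0<..} \<nu> \<partial>lborel)"
        unfolding ray_avg_def by (rule nn_integral_add) measurable
      also have "(\<integral>\<^sup>+\<nu>. ennreal (ray_avg (?B \<nu>) x n) * indicator {0<..} \<nu> \<partial>lborel) =
          nn_ray_avg (\<lambda>z. ennreal (emission W z)) x n"
        unfolding swap[symmetric]
        by (rule nn_integral_cong_AE) (use ray in \<open>auto elim: eventually_mono\<close>)
      also have "(\<integral>\<^sup>+\<nu>. ennreal (incoming \<nu> n) * ennreal (transmission x n) \<partial>lborel) =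
          ennreal (incoming_total n) * ennreal (transmission x n)"
        unfolding elim(1)[symmetric] nn_incoming_def by (rule nn_integral_multc) measurable
      also have "nn_ray_avg (\<lambda>z. ennreal (emission W z)) x n = ennreal (ray_avg (emission W) x n)"
      proof -
        have "integrable path_length_law (\<lambda>t. emission W (x - t *\<^sub>R n))"
          using elim(2) by (intro integrableI_nonneg) (auto simp: emission_nonneg nn_ray_avg_def less_top)
        then show ?thesis
          unfolding nn_ray_avg_def ray_avg_def by (intro nn_integral_eq_integral) (auto simp: emission_nonneg)
      qed
      also have "ennreal (incoming_total n) * ennreal (transmission x n) + ennreal (ray_avg (emission W) x n) =
          ennreal (total_intensity (emission W) x n)"
      proof -
        have "0 \<le> ray_avg (emission W) x n"
          unfolding ray_avg_def by (intro integral_nonneg_AE) (auto simp: emission_nonneg)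
        then show ?thesis
          using G_nonneg[of n] transmission_bounds[of x n]
          by (simp add: total_intensity_def ennreal_mult)
      qed
      finally show ?case .
    qed
  qed
  have I: "integrable (lborel \<Otimes>\<^sub>M sphere_borel) (\<lambda>(\<nu>, n). ?H \<nu> n *\<^sub>R n)"
  proof (rule integrableI_bounded)
    have "(\<integral>\<^sup>+p. ennreal (norm (case p of (\<nu>, n) \<Rightarrow> ?H \<nu> n *\<^sub>R n)) \<partial>(lborel \<Otimes>\<^sub>M sphere_borel)) =
        (\<integral>\<^sup>+n. \<integral>\<^sup>+\<nu>. ennreal (norm (?H \<nu> n *\<^sub>R n)) \<partial>lborel \<partial>sphere_borel)"
      by (subst lborel_frequency_sphere.nn_integral_snd[symmetric]) auto
    also have "\<dots> \<le> (\<integral>\<^sup>+n. ennreal (incoming_total n) + nn_ray_avg (\<lambda>z. ennreal (emission W z)) x n \<partial>sphere_borel)"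
    proof (rule nn_integral_mono_AE)
      show "AE n in sphere_borel. (\<integral>\<^sup>+\<nu>. ennreal (norm (?H \<nu> n *\<^sub>R n)) \<partial>lborel) \<le>
          ennreal (incoming_total n) + nn_ray_avg (\<lambda>z. ennreal (emission W z)) x n"
        using total AE_sphere_borel_norm
      proof eventually_elim
        case (elim n)
        have "(\<integral>\<^sup>+\<nu>. ennreal (norm (?H \<nu> n *\<^sub>R n)) \<partial>lborel) = ennreal (total_intensity (emission W) x n)"
          using elim H_nonneg by simp
        also have "\<dots> \<le> ennreal (incoming_total n + \<bar>ray_avg (emission W) x n\<bar>)"
        proof (rule ennreal_leI)
          have "incoming_total n * transmission x n \<le> incoming_total n"
            using G_nonneg[of n] transmission_bounds(2)[of x n] by (simp add: mult_left_le)
          then show "total_intensity (emission W) x n \<le> incoming_total n + \<bar>ray_avg (emission W) x n\<bar>"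
            unfolding total_intensity_def by linarith
        qed
        also have "\<dots> = ennreal (incoming_total n) + ennreal \<bar>ray_avg (emission W) x n\<bar>"
          using G_nonneg[of n] by simp
        also have "\<dots> \<le> ennreal (incoming_total n) + nn_ray_avg (\<lambda>z. ennreal (emission W z)) x n"
          using ennreal_ray_avg_le[of "emission W" x n] by (intro add_left_mono) (simp add: u_abs)
        finally show ?case .
      qed
    qed
    also have "\<dots> = boundary_energy g + (\<integral>\<^sup>+n. nn_ray_avg (\<lambda>z. ennreal (emission W z)) x n \<partial>sphere_borel)"
      by (subst nn_integral_add) (auto simp: nn_integral_incoming_total)
    also have "\<dots> < \<infinity>" using energy_finite fin by simp
    finally show "(\<integral>\<^sup>+p. ennreal (norm (case p of (\<nu>, n) \<Rightarrow> ?H \<nu> n *\<^sub>R n)) \<partial>(lborel \<Otimes>\<^sub>M sphere_borel)) < \<infinity>" .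
  qed measurable
  have "spectral_flux W x = (LINT n|sphere_borel. LINT \<nu>|lborel. ?H \<nu> n *\<^sub>R n)"
    unfolding spectral_flux_def using lborel_frequency_sphere.Fubini_integral[OF I] by simp
  also have "\<dots> = total_flux (emission W) x"
    unfolding total_flux_def
  proof (rule integral_cong_AE)
    show "AE n in sphere_borel. (LINT \<nu>|lborel. ?H \<nu> n *\<^sub>R n) = total_intensity (emission W) x n *\<^sub>R n"
      using total
    proof eventually_elim
      case (elim n)
      have "integrable lborel (\<lambda>\<nu>. ?H \<nu> n)"
        using elim by (intro integrableI_nonneg) (auto simp: H_nonneg)
      moreover have "(LINT \<nu>|lborel. ?H \<nu> n) = total_intensity (emission W) x n"
        using elim total_intensity_nonneg[of "emission W" x n] emission_nonneg
        by (subst integral_eq_nn_integral) (auto simp: H_nonneg)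
      ultimately show ?case by simp
    qed
  qed measurable
  finally show ?case .
qed

text \<open>
  A temperature is measurable only on \<open>\<Omega>\<close> and nonnegative only almost everywhere; this representative has
  both properties everywhere.
\<close>

definition cut_off :: "(real^3 \<Rightarrow> real) \<Rightarrow> real^3 \<Rightarrow> real" where
  "cut_off T z = max 0 (indicat_real \<Omega> z * T z)"

lemma integrable_emission_cut_off:
  assumes "in_L4 \<Omega> T"
  shows "cut_off T \<in> borel_measurable borel" "integrable lborel (emission (cut_off T))"
proof -
  have [measurable]: "(\<lambda>z. indicat_real \<Omega> z * T z) \<in> borel_measurable borel"
    using assms by (simp add: in_L4_def set_borel_measurable_def)
  then show [measurable]: "cut_off T \<in> borel_measurable borel"
    unfolding cut_off_def[abs_def] by measurable
  have "integrable lborel (\<lambda>x. radiation_constant h c k * (indicat_real \<Omega> x *\<^sub>R \<bar>T x\<bar> ^ 4))"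
    using assms by (simp add: in_L4_def set_integrable_def)
  then show "integrable lborel (emission (cut_off T))"
  proof (rule Bochner_Integration.integrable_bound)
    show "AE x in lborel. norm (emission (cut_off T) x) \<le>
        norm (radiation_constant h c k * (indicat_real \<Omega> x *\<^sub>R \<bar>T x\<bar> ^ 4))"
      using radiation_constant_pos[OF h_pos c_pos k_pos]
      by (intro AE_I2) (auto simp: emission_def cut_off_def indicator_def max_def)
  qed measurable
qed

lemma divergence_free_flux_iff:
  assumes T: "in_L4 \<Omega> T" and nonneg: "AE x in lborel. x \<in> \<Omega> \<longrightarrow> 0 \<le> T x"
  shows "divergence_free_on \<Omega> (flux h c k \<Omega> g T) \<longleftrightarrow>
    (AE x in lborel. x \<in> \<Omega> \<longrightarrow>
      measure sphere_borel UNIV * emission (cut_off T) x = mean_intensity (emission (cut_off T)) x)"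
proof -
  let ?W = "\<lambda>z. indicat_real \<Omega> z * T z"
  have [measurable]: "?W \<in> borel_measurable borel"
    using T by (simp add: in_L4_def set_borel_measurable_def)
  note int = integrable_emission_cut_off[OF T]
  have [measurable]: "cut_off T \<in> borel_measurable borel" by (rule int)
  have eq: "AE z in lborel. ?W z = cut_off T z"
    using nonneg by eventually_elim (auto simp: cut_off_def indicator_def)
  have restrict: "indicat_real \<Omega> x *\<^sub>R flux h c k \<Omega> g T x = indicat_real \<Omega> x *\<^sub>R spectral_flux ?W x" for x
    by (cases "x \<in> \<Omega>") (auto simp: flux_eq_spectral_flux)
  have "divergence_free_on \<Omega> (flux h c k \<Omega> g T) \<longleftrightarrow> divergence_free_on \<Omega> (total_flux (emission (cut_off T)))"
  proof (rule divergence_free_on_cong_AE)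
    show "(\<lambda>x. indicat_real \<Omega> x *\<^sub>R flux h c k \<Omega> g T x) \<in> borel_measurable borel"
      unfolding restrict by measurable
    show "(\<lambda>x. indicat_real \<Omega> x *\<^sub>R total_flux (emission (cut_off T)) x) \<in> borel_measurable borel"
      by measurable
    show "AE x in lborel. x \<in> \<Omega> \<longrightarrow> flux h c k \<Omega> g T x = total_flux (emission (cut_off T)) x"
    proof -
      have "AE x in lborel. spectral_flux ?W x = spectral_flux (cut_off T) x"
        by (rule spectral_flux_cong_AE[OF _ _ eq]) measurable
      moreover have "AE x in lborel. spectral_flux (cut_off T) x = total_flux (emission (cut_off T)) x"
        by (rule spectral_flux_eq_total_flux[OF int(1) _ int(2)]) (simp add: cut_off_def)
      ultimately show ?thesis
        by eventually_elim (simp add: flux_eq_spectral_flux)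
    qed
  qed
  then show ?thesis using total_flux_divergence_free_iff[OF int(2)] by simp
qed

section \<open>Existence and uniqueness of the temperature\<close>

theorem unique_temperature:
  "\<exists>T. temperature_solution h c k \<Omega> g T \<and>
     (boundary_energy g > 0 \<longrightarrow> (AE x in lborel. x \<in> \<Omega> \<longrightarrow> T x > 0)) \<and>
     (\<forall>T'. temperature_solution h c k \<Omega> g T' \<longrightarrow> (AE x in lborel. x \<in> \<Omega> \<longrightarrow> T' x = T x))"
proof -
  let ?\<sigma> = "radiation_constant h c k"
  have \<sigma>: "?\<sigma> > 0" by (rule radiation_constant_pos[OF h_pos c_pos k_pos])
  obtain u where u: "integrable lborel u" "\<And>x. 0 \<le> u x" "\<And>x. x \<notin> \<Omega> \<Longrightarrow> u x = 0"
    "AE x in lborel. x \<in> \<Omega> \<longrightarrow> measure sphere_borel UNIV * u x = mean_intensity u x"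
    "(LINT n|sphere_borel. incoming_total n) > 0 \<Longrightarrow> AE x in lborel. x \<in> \<Omega> \<longrightarrow> 0 < u x"
    by (rule radiative_equilibrium_exists) blast
  have [measurable]: "u \<in> borel_measurable borel" using u by auto
  define T where "T x = root 4 (u x / ?\<sigma>)" for x
  have [measurable]: "T \<in> borel_measurable borel"
    unfolding T_def[abs_def] by measurable
  have T_nonneg: "0 \<le> T x" for x using u(2)[of x] \<sigma> by (simp add: T_def)
  have T4: "T x ^ 4 = u x / ?\<sigma>" for x using u(2)[of x] \<sigma> by (simp add: T_def)
  have cut_T: "cut_off T x = T x" for x
    using T_nonneg[of x] u(3)[of x] by (auto simp: cut_off_def indicator_def T_def)
  have em_T: "emission (cut_off T) = u"
    using \<sigma> by (auto simp: emission_def cut_T T4)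
  have L4: "in_L4 \<Omega> T"
    unfolding in_L4_def
  proof
    show "set_borel_measurable borel \<Omega> T" unfolding set_borel_measurable_def by measurable
    have "integrable lborel (\<lambda>x. u x / ?\<sigma>)" using u(1) by simp
    then show "set_integrable lborel \<Omega> (\<lambda>x. \<bar>T x\<bar> ^ 4)"
      unfolding set_integrable_def using integrable_mult_indicator[of \<Omega> lborel "\<lambda>x. u x / ?\<sigma>"]
      by (simp add: T4)
  qed
  have sol: "temperature_solution h c k \<Omega> g T"
    unfolding temperature_solution_def
    using L4 T_nonneg u(4) by (simp add: divergence_free_flux_iff em_T)
  moreover have "AE x in lborel. x \<in> \<Omega> \<longrightarrow> T x > 0" if "boundary_energy g > 0"
  proof -
    have "ennreal (LINT n|sphere_borel. incoming_total n) = boundary_energy g"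
      using nn_integral_eq_integral[OF integrable_incoming_total] G_nonneg
      by (simp add: nn_integral_incoming_total)
    with that have "(LINT n|sphere_borel. incoming_total n) > 0" by (metis ennreal_less_zero_iff ennreal_eq_0_iff not_less)
    from u(5)[OF this] show ?thesis
      by eventually_elim (use \<sigma> in \<open>simp add: T_def\<close>)
  qed
  moreover have "AE x in lborel. x \<in> \<Omega> \<longrightarrow> T' x = T x" if T': "temperature_solution h c k \<Omega> g T'" for T'
  proof -
    from T' have L4': "in_L4 \<Omega> T'" and nn: "AE x in lborel. x \<in> \<Omega> \<longrightarrow> 0 \<le> T' x"
      and div: "divergence_free_on \<Omega> (flux h c k \<Omega> g T')"
      by (auto simp: temperature_solution_def)
    have "AE x in lborel. u x = emission (cut_off T') x"
    proof (rule radiative_equilibrium_unique)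
      show "AE x in lborel. x \<in> \<Omega> \<longrightarrow> measure sphere_borel UNIV * emission (cut_off T') x =
          mean_intensity (emission (cut_off T')) x"
        using div divergence_free_flux_iff[OF L4' nn] by simp
      show "emission (cut_off T') x = 0" if "x \<notin> \<Omega>" for x
        using that by (simp add: emission_def cut_off_def)
    qed (use u integrable_emission_cut_off[OF L4'] in auto)
    with nn show ?thesis
    proof eventually_elim
      case (elim x)
      show ?case
      proof
        assume x: "x \<in> \<Omega>"
        then have "cut_off T' x = T' x" using elim by (simp add: cut_off_def)
        with elim(2) \<sigma> have "T' x ^ 4 = T x ^ 4" by (simp add: T4 emission_def)
        then show "T' x = T x"
          by (rule power_eq_imp_eq_base) (use elim(1) x T_nonneg in auto)
      qed
    qed
  qed
  ultimately show ?thesis by blast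
qed

end

theorem theorem3p1:
  fixes h c k :: real
    and \<Omega> :: "(real^3) set"
    and g :: "real \<Rightarrow> real^3 \<Rightarrow> real"
  assumes "h > 0" and "c > 0" and "k > 0"
    and "open \<Omega>" and "connected \<Omega>" and "\<Omega> \<noteq> {}" and "bounded \<Omega>"
    and "convex \<Omega>" and "C1_boundary \<Omega>"
    and "set_borel_measurable borel ({0<..} \<times> sphere 0 1) (\<lambda>(\<nu>, n). g \<nu> n)"
    and "\<And>\<nu> n. \<nu> > 0 \<Longrightarrow> n \<in> sphere 0 1 \<Longrightarrow> g \<nu> n \<ge> 0"
    and "boundary_energy g < \<infinity>"
  shows "\<exists>T. temperature_solution h c k \<Omega> g T \<and>
           (boundary_energy g > 0 \<longrightarrow> (AE x in lborel. x \<in> \<Omega> \<longrightarrow> T x > 0)) \<and>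
           (\<forall>T'. temperature_solution h c k \<Omega> g T' \<longrightarrow>
              (AE x in lborel. x \<in> \<Omega> \<longrightarrow> T' x = T x))"
proof -
  interpret radiative_transfer h c k \<Omega> g
    by unfold_locales (use assms in auto)
  show ?thesis by (rule unique_temperature)
qed

end
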